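(* Let $(\mathbb{R}^n,g)$ be a pseudo-Euclidean space, $n\ge 3$, with coordinates $x=(x_1,\dots,x_n)$ and $g_{ij}=\delta_{ij}\varepsilon_i$, $\varepsilon_i\in\{-1,1\}$. Let $M=(\mathbb{R}^n,\bar g)\times_f F^m$ be a warped product, where $\bar g=\frac{1}{\varphi^2}g$, $F$ is a scalar-flat semi-Riemannian manifold of dimension $m\ge 1$, and $f,\varphi,h:\mathbb{R}^n\to\mathbb{R}$ are smooth functions with $f>0$ which are functions $f(\xi),\varphi(\xi),h(\xi)$ of $\xi=\sum_{k=1}^n\alpha_kx_k$, where $\alpha_k\in\mathbb{R}$ and $\sum_{k=1}^n\varepsilon_k\alpha_k^2=\varepsilon_{k_0}\in\{-1,1\}$. Then, given a smooth function $\varphi>0$, the warped product metric $\tilde g=\bar g\oplus f^2g_F$ is a steady gradient Yamabe soliton with potential function $h$ and $h'=0$ if and only if $f$ and $h$ satisfy $$h(\xi)=\text{constant},$$ $$f=\varphi^{\frac{n-2}{m+1}}\,e^{\int z_p\,d\xi}\left(\int e^{-(m+1)\int z_p\,d\xi}\,d\xi+\frac{2}{m+1}C\right)^{\frac{2}{m+1}}$$ for some constant $C\in\mathbb{R}$ and some function $z_p=z_p(\xi)$ that is a (particular) solution of the Riccati equation $$z^2+\frac{2}{m+1}z'+\frac{n+m-1}{m(m+1)^2}\left(n\Big(\frac{\varphi'}{\varphi}\Big)^2-2\frac{\varphi''}{\varphi}\right)=0.$$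
   Context: A pseudo-Riemannian manifold $(M,g)$ is a gradient Yamabe soliton with potential function $h$ if there is a real constant $\rho$ with $(S_g-\rho)g=\mathrm{Hess}_g(h)$, where $S_g$ is the scalar curvature; it is steady if $\rho=0$, i.e. $S_g\,g=\mathrm{Hess}_g(h)$. The warped product $B\times_f F$ is $B\times F$ with metric $\tilde g=g_B\oplus f^2g_F$. Scalar-flat means scalar curvature identically zero. The function $h$ on $\mathbb{R}^n$ is regarded as a function on $M=\mathbb{R}^n\times F$ by composing with the projection to $\mathbb{R}^n$. Primes denote derivatives with respect to $\xi$. Integrals are indefinite integrals (antiderivatives, determined up to an additive constant); both occurrences of $\int z_p\,d\xi$ are antiderivatives of $z_p$.
   Formalization: The formula for f, with C and the Riccati solution z_p, is asserted on every bounded open interval of ξ (C and z_p may depend on it), since one z_p on all of ℝ need not exist: for φ=f=1 only z_p=0 is global and it gives a nonconstant f. *)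

theory Defs
  imports "HOL-Analysis.Analysis"
begin

subsection \<open>Smooth maps and partial derivatives\<close>

text \<open>Intended for open \<open>S\<close>.\<close>

fun Ck_on :: "nat \<Rightarrow> 'a::real_normed_vector set \<Rightarrow> ('a \<Rightarrow> 'b::real_normed_vector) \<Rightarrow> bool" where
  "Ck_on 0 S f \<longleftrightarrow> continuous_on S f"
| "Ck_on (Suc k) S f \<longleftrightarrow> (\<forall>x\<in>S. f differentiable (at x)) \<and>
     (\<forall>v. Ck_on k S (\<lambda>x. frechet_derivative f (at x) v))"

definition smooth_on :: "'a::real_normed_vector set \<Rightarrow> ('a \<Rightarrow> 'b::real_normed_vector) \<Rightarrow> bool" where
  "smooth_on S f \<longleftrightarrow> (\<forall>k. Ck_on k S f)"

definition pd :: "'k \<Rightarrow> (real^'k \<Rightarrow> real) \<Rightarrow> real^'k \<Rightarrow> real" where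
  "pd i u x = frechet_derivative u (at x) (axis i 1)"

subsection \<open>Semi-Riemannian geometry in coordinates\<close>

text \<open>Here \<open>G\<close> is the matrix of metric components as a function on an open subset of
  \<open>real^'k\<close>. Conventions:
  \<open>R\<^sup>l\<^bsub>kij\<^esub> = \<partial>\<^sub>i \<Gamma>\<^sup>l\<^bsub>jk\<^esub> - \<partial>\<^sub>j \<Gamma>\<^sup>l\<^bsub>ik\<^esub> + \<Gamma>\<^sup>l\<^bsub>is\<^esub> \<Gamma>\<^sup>s\<^bsub>jk\<^esub> - \<Gamma>\<^sup>l\<^bsub>js\<^esub> \<Gamma>\<^sup>s\<^bsub>ik\<^esub>\<close>
  and \<open>Ric\<^bsub>jk\<^esub> = R\<^sup>i\<^bsub>kij\<^esub>\<close>, so that round spheres have positive scalar curvature.\<close>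

definition christoffel ::
  "(real^'k \<Rightarrow> real^'k^'k) \<Rightarrow> 'k \<Rightarrow> 'k \<Rightarrow> 'k \<Rightarrow> real^'k \<Rightarrow> real" where
  "christoffel G l i j x = (\<Sum>s\<in>UNIV. matrix_inv (G x) $ l $ s *
     (pd i (\<lambda>y. G y $ j $ s) x + pd j (\<lambda>y. G y $ i $ s) x - pd s (\<lambda>y. G y $ i $ j) x)) / 2"

definition riemann_coord ::
  "(real^'k \<Rightarrow> real^'k^'k) \<Rightarrow> 'k \<Rightarrow> 'k \<Rightarrow> 'k \<Rightarrow> 'k \<Rightarrow> real^'k \<Rightarrow> real" where
  "riemann_coord G l k i j x =
     pd i (christoffel G l j k) x - pd j (christoffel G l i k) x
     + (\<Sum>s\<in>UNIV. christoffel G l i s x * christoffel G s j k x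
                - christoffel G l j s x * christoffel G s i k x)"

definition ricci_coord ::
  "(real^'k \<Rightarrow> real^'k^'k) \<Rightarrow> 'k \<Rightarrow> 'k \<Rightarrow> real^'k \<Rightarrow> real" where
  "ricci_coord G j k x = (\<Sum>i\<in>UNIV. riemann_coord G i k i j x)"

definition scalar_coord :: "(real^'k \<Rightarrow> real^'k^'k) \<Rightarrow> real^'k \<Rightarrow> real" where
  "scalar_coord G x = (\<Sum>j\<in>UNIV. \<Sum>k\<in>UNIV. matrix_inv (G x) $ j $ k * ricci_coord G j k x)"

definition hessian_coord ::
  "(real^'k \<Rightarrow> real^'k^'k) \<Rightarrow> (real^'k \<Rightarrow> real) \<Rightarrow> 'k \<Rightarrow> 'k \<Rightarrow> real^'k \<Rightarrow> real" where
  "hessian_coord G u i j x = pd i (pd j u) x - (\<Sum>k\<in>UNIV. christoffel G k i j x * pd k u x)"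

subsection \<open>Smooth manifolds and semi-Riemannian metrics\<close>

text \<open>A manifold is a topology on (a subset of) \<open>'p\<close> with an indexed smooth atlas: chart number
  \<open>i\<close> has domain \<open>cdom M i\<close> and coordinate map \<open>chart M i\<close>. Its dimension is \<open>CARD('k)\<close>.\<close>

record ('p, 'i, 'k) charted =
  topo :: "'p topology"
  idx :: "'i set"
  cdom :: "'i \<Rightarrow> 'p set"
  chart :: "'i \<Rightarrow> 'p \<Rightarrow> real^'k"

definition param :: "('p, 'i, 'k::finite) charted \<Rightarrow> 'i \<Rightarrow> real^'k \<Rightarrow> 'p" where
  "param M i = inv_into (cdom M i) (chart M i)"

definition transition ::
  "('p, 'i, 'k::finite) charted \<Rightarrow> 'i \<Rightarrow> 'i \<Rightarrow> real^'k \<Rightarrow> real^'k" where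
  "transition M i j = chart M j \<circ> param M i"

definition smooth_manifold :: "('p, 'i, 'k::finite) charted \<Rightarrow> bool" where
  "smooth_manifold M \<longleftrightarrow>
     topspace (topo M) \<noteq> {} \<and> Hausdorff_space (topo M) \<and> second_countable (topo M) \<and>
     (\<Union>i\<in>idx M. cdom M i) = topspace (topo M) \<and>
     (\<forall>i\<in>idx M. openin (topo M) (cdom M i) \<and> open (chart M i ` cdom M i) \<and>
        homeomorphic_map (subtopology (topo M) (cdom M i)) (top_of_set (chart M i ` cdom M i))
          (chart M i)) \<and>
     (\<forall>i\<in>idx M. \<forall>j\<in>idx M.
        smooth_on (chart M i ` (cdom M i \<inter> cdom M j)) (transition M i j))"

text \<open>A field of bilinear forms on \<open>M\<close> is given by its component matrices: \<open>g i p\<close> is the matrix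
  at the point \<open>p\<close> with respect to the coordinate frame of chart \<open>i\<close>.\<close>

type_synonym ('p, 'i, 'k) metric = "'i \<Rightarrow> 'p \<Rightarrow> real^'k^'k"

definition metric_index :: "real^'k^'k \<Rightarrow> nat" where
  "metric_index A = Max {dim V | V. subspace V \<and> (\<forall>v\<in>V. v \<noteq> 0 \<longrightarrow> v \<bullet> (A *v v) < 0)}"

definition semi_riemannian_manifold ::
  "('p, 'i, 'k::finite) charted \<Rightarrow> ('p, 'i, 'k) metric \<Rightarrow> bool" where
  "semi_riemannian_manifold M g \<longleftrightarrow> smooth_manifold M \<and>
     (\<forall>i\<in>idx M. smooth_on (chart M i ` cdom M i) (g i \<circ> param M i)) \<and>
     (\<forall>i\<in>idx M. \<forall>p\<in>cdom M i. transpose (g i p) = g i p \<and> invertible (g i p)) \<and>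
     (\<forall>i\<in>idx M. \<forall>j\<in>idx M. \<forall>p\<in>cdom M i \<inter> cdom M j.
        let J = matrix (frechet_derivative (transition M i j) (at (chart M i p)))
        in g i p = transpose J ** g j p ** J) \<and>
     (\<exists>\<nu>. \<forall>i\<in>idx M. \<forall>p\<in>cdom M i. metric_index (g i p) = \<nu>)"

text \<open>The following are the values at \<open>p\<close> as computed in chart \<open>i\<close>. The scalar curvature does not
  depend on the chart, and the Hessian transforms like the metric, so the notions below
  are required in all charts of the atlas.\<close>

definition scalar_curvature ::
  "('p, 'i, 'k::finite) charted \<Rightarrow> ('p, 'i, 'k) metric \<Rightarrow> 'i \<Rightarrow> 'p \<Rightarrow> real" where
  "scalar_curvature M g i p = scalar_coord (g i \<circ> param M i) (chart M i p)"

definition hessian ::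
  "('p, 'i, 'k::finite) charted \<Rightarrow> ('p, 'i, 'k) metric \<Rightarrow> ('p \<Rightarrow> real) \<Rightarrow> 'i \<Rightarrow> 'p \<Rightarrow> real^'k^'k" where
  "hessian M g u i p =
     (\<chi> a b. hessian_coord (g i \<circ> param M i) (u \<circ> param M i) a b (chart M i p))"

definition scalar_flat :: "('p, 'i, 'k::finite) charted \<Rightarrow> ('p, 'i, 'k) metric \<Rightarrow> bool" where
  "scalar_flat M g \<longleftrightarrow> (\<forall>i\<in>idx M. \<forall>p\<in>cdom M i. scalar_curvature M g i p = 0)"

definition yamabe_soliton_eq ::
  "('p, 'i, 'k::finite) charted \<Rightarrow> ('p, 'i, 'k) metric \<Rightarrow> ('p \<Rightarrow> real) \<Rightarrow> real \<Rightarrow> bool" where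
  "yamabe_soliton_eq M g u \<rho> \<longleftrightarrow> (\<forall>i\<in>idx M. \<forall>p\<in>cdom M i.
     (scalar_curvature M g i p - \<rho>) *\<^sub>R g i p = hessian M g u i p)"

definition gradient_yamabe_soliton ::
  "('p, 'i, 'k::finite) charted \<Rightarrow> ('p, 'i, 'k) metric \<Rightarrow> ('p \<Rightarrow> real) \<Rightarrow> bool" where
  "gradient_yamabe_soliton M g u \<longleftrightarrow> (\<exists>\<rho>. yamabe_soliton_eq M g u \<rho>)"

definition steady_gradient_yamabe_soliton ::
  "('p, 'i, 'k::finite) charted \<Rightarrow> ('p, 'i, 'k) metric \<Rightarrow> ('p \<Rightarrow> real) \<Rightarrow> bool" where
  "steady_gradient_yamabe_soliton M g u \<longleftrightarrow> yamabe_soliton_eq M g u 0"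

subsection \<open>Warped products\<close>

definition vec_join :: "real^'a \<Rightarrow> real^'b \<Rightarrow> real^('a + 'b)" where
  "vec_join x y = (\<chi> k. case k of Inl a \<Rightarrow> x $ a | Inr b \<Rightarrow> y $ b)"

definition block_diag :: "real^'a^'a \<Rightarrow> real^'b^'b \<Rightarrow> real^('a + 'b)^('a + 'b)" where
  "block_diag A B = (\<chi> k l. case k of
       Inl a \<Rightarrow> (case l of Inl a' \<Rightarrow> A $ a $ a' | Inr b' \<Rightarrow> 0)
     | Inr b \<Rightarrow> (case l of Inl a' \<Rightarrow> 0 | Inr b' \<Rightarrow> B $ b $ b'))"

definition prod_manifold ::
  "('p, 'i, 'a::finite) charted \<Rightarrow> ('q, 'j, 'b::finite) charted \<Rightarrow> ('p \<times> 'q, 'i \<times> 'j, 'a + 'b) charted"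
where
  "prod_manifold M N = \<lparr>
     topo = prod_topology (topo M) (topo N),
     idx = idx M \<times> idx N,
     cdom = (\<lambda>(i, j). cdom M i \<times> cdom N j),
     chart = (\<lambda>(i, j) (p, q). vec_join (chart M i p) (chart N j q)) \<rparr>"

definition warped_metric ::
  "('p, 'i, 'a::finite) metric \<Rightarrow> ('p \<Rightarrow> real) \<Rightarrow> ('q, 'j, 'b::finite) metric
    \<Rightarrow> ('p \<times> 'q, 'i \<times> 'j, 'a + 'b) metric" where
  "warped_metric gB f gF = (\<lambda>(i, j) (p, q). block_diag (gB i p) ((f p)\<^sup>2 *\<^sub>R gF j q))"

definition euclidean_manifold :: "(real^'n, unit, 'n::finite) charted" where
  "euclidean_manifold = \<lparr> topo = euclidean, idx = UNIV, cdom = (\<lambda>_. UNIV), chart = (\<lambda>_ x. x) \<rparr>"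

definition pseudo_euclidean_metric :: "('n::finite \<Rightarrow> real) \<Rightarrow> (real^'n, unit, 'n) metric" where
  "pseudo_euclidean_metric \<epsilon> = (\<lambda>_ _. \<chi> i j. if i = j then \<epsilon> i else 0)"

definition conformal_metric ::
  "('p \<Rightarrow> real) \<Rightarrow> ('p, 'i, 'k::finite) metric \<Rightarrow> ('p, 'i, 'k) metric" where
  "conformal_metric \<phi> g = (\<lambda>i p. (1 / (\<phi> p)\<^sup>2) *\<^sub>R g i p)"

subsection \<open>The Riccati equation and the closed form of the warping function\<close>

definition riccati_solution_on ::
  "real set \<Rightarrow> real \<Rightarrow> real \<Rightarrow> (real \<Rightarrow> real) \<Rightarrow> (real \<Rightarrow> real) \<Rightarrow> bool" where
  "riccati_solution_on J n m \<phi> z \<longleftrightarrow> (\<forall>t\<in>J. z differentiable (at t) \<and>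
     (z t)\<^sup>2 + 2 / (m + 1) * deriv z t
       + (n + m - 1) / (m * (m + 1)\<^sup>2) * (n * (deriv \<phi> t / \<phi> t)\<^sup>2 - 2 * (deriv (deriv \<phi>) t / \<phi> t))
     = 0)"

definition antiderivative_on :: "real set \<Rightarrow> (real \<Rightarrow> real) \<Rightarrow> (real \<Rightarrow> real) \<Rightarrow> bool" where
  "antiderivative_on J u U \<longleftrightarrow> (\<forall>t\<in>J. (U has_real_derivative u t) (at t))"

text \<open>\<open>Z1\<close>, \<open>Z2\<close> stand for the two occurrences of the antiderivative of \<open>z\<close>, and \<open>E\<close> for the outer
  one. The base of the real power has to be positive for the formula to make sense.

  The representation is a statement about an interval \<open>J\<close> on which \<open>z\<close> solves the Riccati
  equation. It cannot be demanded with a single \<open>z\<close> on the whole line: for \<open>\<phi> = f = 1\<close> the only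
  solution of the Riccati equation on all of \<open>\<real>\<close> is \<open>z = 0\<close>, which gives a nonconstant affine
  base, whereas on \<open>{..<b}\<close> one may take \<open>z t = 2 / ((m + 1) * (t - b))\<close>.\<close>

definition warping_formula_on ::
  "real set \<Rightarrow> real \<Rightarrow> real \<Rightarrow> (real \<Rightarrow> real) \<Rightarrow> (real \<Rightarrow> real) \<Rightarrow> real \<Rightarrow> (real \<Rightarrow> real) \<Rightarrow> bool" where
  "warping_formula_on J n m \<phi> f C z \<longleftrightarrow> (\<exists>Z1 Z2 E.
     antiderivative_on J z Z1 \<and> antiderivative_on J z Z2 \<and>
     antiderivative_on J (\<lambda>t. exp (- (m + 1) * Z2 t)) E \<and>
     (\<forall>t\<in>J. E t + 2 / (m + 1) * C > 0 \<and>
        f t = \<phi> t powr ((n - 2) / (m + 1)) * exp (Z1 t)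
                * (E t + 2 / (m + 1) * C) powr (2 / (m + 1))))"

end

theory Submission
  imports Defs
begin

text \<open>If the potential is constant, its Hessian vanishes, and since the metric is nowhere zero the
  soliton equation says precisely that the warped product has vanishing scalar curvature. The
  potential is a smooth function of \<open>\<xi>\<close>, so it is constant exactly if \<open>h' = 0\<close>. The content is
  therefore the solution of the equation of vanishing scalar curvature.

  With \<open>p = \<phi>' / \<phi>\<close> and \<open>L = f' / f\<close>, the Christoffel symbols in a product chart are
  polynomial in \<open>p\<close>, \<open>L\<close>, \<open>\<phi>\<^sup>2 f\<^sup>2\<close> and the metric components and Christoffel symbols of the
  fibre. Contracting the curvature tensor (lemmas \<open>scalar_G\<close> and
  \<open>warped_product_scalar_curvature\<close>) shows that over a scalar-flat fibre the scalar curvature is \<open>g(\<nabla>\<xi>, \<nabla>\<xi>) \<phi>\<^sup>2\<close> times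

  \<open>(n - 1) (2 p' - (n - 2) p\<^sup>2) - 2 m L' - m (m + 1) L\<^sup>2 + 2 m (n - 2) p L\<close>.

  Since \<open>g(\<nabla>\<xi>, \<nabla>\<xi>) = \<plusminus>1\<close> and the values of \<open>\<xi>\<close> fill the real line, the scalar curvature
  vanishes if and only if this expression is zero for all \<open>\<xi>\<close>.

  Writing \<open>f = \<phi>\<^bsup>(n-2)/(m+1)\<^esup> u\<^bsup>2/(m+1)\<^esup>\<close> turns the last condition into a linear equation
  \<open>u'' + q u = 0\<close>, and the Riccati equation in the statement is the equation for
  \<open>z = 2 / (m + 1) \<cdot> w' / w\<close> with \<open>w\<close> a positive solution of the same linear equation. The
  closed form of \<open>f\<close> expresses \<open>u\<close> by \<open>w\<close> through reduction of order, as
  \<open>u = w (\<integral> w\<^sup>-\<^sup>2 + const)\<close>. That the closed form implies the equation is a computation with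
  logarithmic derivatives (lemma \<open>warped_scalar_zero_if_formula\<close>). Conversely, \<open>u\<close> is given,
  and on a bounded interval the function \<open>w = u (const - \<integral> u\<^sup>-\<^sup>2)\<close> is a second solution, positive
  for a large constant, from which \<open>u\<close> is recovered by the closed form (lemma
  \<open>formula_if_warped_scalar_zero\<close>).\<close>

section \<open>Partial derivatives on a product chart\<close>

lemma sum_UNIV_Plus:
  fixes g :: "'a::finite + 'b::finite \<Rightarrow> 'c::comm_monoid_add"
  shows "(\<Sum>k\<in>UNIV. g k) = (\<Sum>a\<in>UNIV. g (Inl a)) + (\<Sum>b\<in>UNIV. g (Inr b))"
  by (subst UNIV_Plus_UNIV[symmetric], subst sum.Plus) simp_all

lemma sum_if_eq [simp]:
  fixes g :: "'k::finite \<Rightarrow> real"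
  shows "(\<Sum>s\<in>UNIV. (if a = s then g s else 0) * h s) = g a * h a"
    "(\<Sum>s\<in>UNIV. (if s = a then g s else 0) * h s) = g a * h a"
    "(\<Sum>s\<in>UNIV. h s * (if a = s then g s else 0)) = h a * g a"
    "(\<Sum>s\<in>UNIV. h s * (if s = a then g s else 0)) = h a * g a"
  by (simp_all add: if_distrib[of "\<lambda>x. x * _"] if_distrib[of "\<lambda>x. _ * x"] cong: if_cong)

lemma pd_const [simp]: "pd b (\<lambda>_. c) y = 0"
  by (simp add: pd_def)

text \<open>Component formulas hold only on the chart image, which is open; this lets them be
  differentiated there.\<close>

lemma pd_cong_on_open:
  assumes "open W" "z \<in> W" "\<And>w. w \<in> W \<Longrightarrow> u w = v w"
  shows "pd i u z = pd i v z"
proof -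
  have "(u has_derivative D) (at z) \<longleftrightarrow> (v has_derivative D) (at z)" for D
    using has_derivative_transform_within_open[of u D z UNIV W v]
      has_derivative_transform_within_open[of v D z UNIV W u] assms by auto
  then show ?thesis unfolding pd_def frechet_derivative_def by simp
qed

text \<open>On the product chart every component that occurs is a function of the height
  \<open>\<xi> = \<Sum> \<alpha>\<^sub>a x\<^sub>a\<close> times a function of the fibre coordinates. The lemmas
  \<open>pd_separated_Inl\<close> and \<open>pd_separated_Inr\<close> below are therefore the only rules for
  partial derivatives that the curvature computation needs.\<close>

definition fibre_part :: "real^('a::finite + 'b::finite) \<Rightarrow> real^'b" where
  "fibre_part z = (\<chi> b. z $ Inr b)"

definition height :: "real^'a \<Rightarrow> real^('a::finite + 'b::finite) \<Rightarrow> real" where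
  "height \<alpha> z = (\<Sum>a\<in>UNIV. \<alpha> $ a * z $ Inl a)"

lemma bounded_linear_fibre_part: "bounded_linear fibre_part"
  by (rule linear_conv_bounded_linear[THEN iffD1]) (auto intro!: linearI simp: fibre_part_def vec_eq_iff)

lemma bounded_linear_height: "bounded_linear (height \<alpha>)"
  by (rule linear_conv_bounded_linear[THEN iffD1])
     (auto intro!: linearI simp: height_def algebra_simps sum.distrib sum_distrib_left)

lemma separated_derivative:
  fixes z :: "real^('a::finite + 'b::finite)"
  assumes u: "(u has_real_derivative u') (at (height \<alpha> z))"
    and v: "v differentiable (at (fibre_part z))"
  shows pd_separated_Inl: "pd (Inl a) (\<lambda>w. u (height \<alpha> w) * v (fibre_part w)) z
      = u' * \<alpha> $ a * v (fibre_part z)"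
    and pd_separated_Inr: "pd (Inr b) (\<lambda>w. u (height \<alpha> w) * v (fibre_part w)) z
      = u (height \<alpha> z) * pd b v (fibre_part z)"
proof -
  let ?D = "frechet_derivative v (at (fibre_part z))"
  have v': "(v has_derivative ?D) (at (fibre_part z))"
    using v frechet_derivative_works by blast
  have 1: "((\<lambda>w. u (height \<alpha> w)) has_derivative (\<lambda>w. u' * height \<alpha> w)) (at z)"
    using has_derivative_compose[OF bounded_linear_imp_has_derivative[OF bounded_linear_height]
        u[unfolded has_field_derivative_def]] .
  have 2: "((\<lambda>w. v (fibre_part w)) has_derivative (\<lambda>w. ?D (fibre_part w))) (at z)"
    using has_derivative_compose[OF bounded_linear_imp_has_derivative[OF bounded_linear_fibre_part] v'] .
  have D: "frechet_derivative (\<lambda>w. u (height \<alpha> w) * v (fibre_part w)) (at z) =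
     (\<lambda>w. u (height \<alpha> z) * ?D (fibre_part w) + u' * height \<alpha> w * v (fibre_part z))"
    using frechet_derivative_at[OF has_derivative_mult[OF 1 2]] by simp
  have [simp]: "?D 0 = 0"
    using v' has_derivative_bounded_linear linear_simps(3) by blast
  have "fibre_part (axis (Inl a) 1 :: real^('a+'b)) = 0" "height \<alpha> (axis (Inl a) 1 :: real^('a+'b)) = \<alpha> $ a"
    "fibre_part (axis (Inr b) 1 :: real^('a+'b)) = axis b 1" "height \<alpha> (axis (Inr b) 1 :: real^('a+'b)) = 0"
    by (auto simp: fibre_part_def height_def axis_def vec_eq_iff if_distrib cong: if_cong)
  then show "pd (Inl a) (\<lambda>w. u (height \<alpha> w) * v (fibre_part w)) z
      = u' * \<alpha> $ a * v (fibre_part z)"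
    "pd (Inr b) (\<lambda>w. u (height \<alpha> w) * v (fibre_part w)) z
      = u (height \<alpha> z) * pd b v (fibre_part z)"
    unfolding pd_def D by auto
qed

section \<open>Inverse matrices and their differentiability\<close>

lemma matrix_inv_inverse:
  fixes A :: "real^'k^'k"
  assumes "invertible A"
  shows "A ** matrix_inv A = mat 1" "matrix_inv A ** A = mat 1"
proof -
  have "\<exists>B. A ** B = mat 1 \<and> B ** A = mat 1" using assms by (simp add: invertible_def)
  then have "A ** matrix_inv A = mat 1 \<and> matrix_inv A ** A = mat 1"
    unfolding matrix_inv_def by (rule someI_ex)
  then show "A ** matrix_inv A = mat 1" "matrix_inv A ** A = mat 1" by auto
qed

lemma matrix_inv_eqI:
  fixes A :: "real^'k^'k"
  assumes "A ** B = mat 1"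
  shows "matrix_inv A = B"
proof -
  have "B ** A = mat 1" using assms matrix_left_right_inverse by blast
  then have "invertible A" using assms invertible_def by blast
  then have "matrix_inv A ** (A ** B) = B"
    by (simp add: matrix_mul_assoc matrix_inv_inverse)
  then show ?thesis by (simp add: assms)
qed

lemma matrix_inv_block_diag:
  fixes A :: "real^'a::finite^'a" and B :: "real^'b::finite^'b"
  assumes "A ** A' = mat 1" "B ** B' = mat 1"
  shows "matrix_inv (block_diag A B) = block_diag A' B'"
proof (rule matrix_inv_eqI)
  have "(\<Sum>k\<in>UNIV. A $ i $ k * A' $ k $ j) = (if i = j then 1 else 0)" for i j
    using assms(1) by (auto simp: matrix_matrix_mult_def mat_def vec_eq_iff)
  moreover have "(\<Sum>k\<in>UNIV. B $ i $ k * B' $ k $ j) = (if i = j then 1 else 0)" for i j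
    using assms(2) by (auto simp: matrix_matrix_mult_def mat_def vec_eq_iff)
  ultimately have "(block_diag A B ** block_diag A' B') $ i $ j = mat 1 $ i $ j" for i j
    by (cases i; cases j) (simp_all add: matrix_matrix_mult_def mat_def sum_UNIV_Plus block_diag_def)
  then show "block_diag A B ** block_diag A' B' = mat 1"
    unfolding vec_eq_iff by blast
qed

lemma differentiable_det:
  fixes A :: "'x::real_normed_vector \<Rightarrow> real^'k^'k"
  assumes "\<And>i j. (\<lambda>x. A x $ i $ j) differentiable (at x)"
  shows "(\<lambda>x. det (A x)) differentiable (at x)"
proof -
  have "(\<lambda>x. \<Prod>i\<in>I. A x $ i $ q i) differentiable (at x)" for I :: "'k set" and q
  proof (induction I rule: infinite_finite_induct)
  qed (auto intro!: differentiable_mult assms)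
  then show ?thesis unfolding det_def
    by (intro differentiable_sum differentiable_mult differentiable_const finite_permutations ballI finite)
qed

lemma differentiable_transform_open:
  assumes "g differentiable (at x)" "open U" "x \<in> U" "\<And>y. y \<in> U \<Longrightarrow> g y = h y"
  shows "h differentiable (at x)"
proof -
  obtain D where "(g has_derivative D) (at x)" using assms(1) by (auto simp: differentiable_def)
  from has_derivative_transform_within_open[OF this assms(2-4)] show ?thesis
    by (rule differentiableI)
qed

text \<open>By Cramer's rule the entries of the inverse are quotients of determinants, and
  determinants are polynomials in the entries.\<close>

lemma differentiable_matrix_inv:
  fixes A :: "real^'a \<Rightarrow> real^'k^'k"
  assumes "open U" "x \<in> U" and inv: "\<And>y. y \<in> U \<Longrightarrow> invertible (A y)"
    and d: "\<And>i j. (\<lambda>x. A x $ i $ j) differentiable (at x)"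
  shows "(\<lambda>x. matrix_inv (A x) $ l $ s) differentiable (at x)"
proof -
  let ?c = "\<lambda>y. det (\<chi> i j. if j = l then axis s 1 $ i else A y $ i $ j) / det (A y)"
  have eq: "?c y = matrix_inv (A y) $ l $ s" if "y \<in> U" for y
  proof -
    have n: "det (A y) \<noteq> 0" using inv[OF that] by (simp add: invertible_det_nz)
    have "A y *v (matrix_inv (A y) *v axis s 1) = axis s 1"
      using inv[OF that] by (simp add: matrix_vector_mul_assoc matrix_inv_inverse)
    then have "matrix_inv (A y) *v axis s 1
        = (\<chi> k. det (\<chi> i j. if j = k then axis s 1 $ i else A y $ i $ j) / det (A y))"
      by (rule iffD1[OF cramer[OF n]])
    then have "(matrix_inv (A y) *v axis s 1) $ l = ?c y" by simp
    then show ?thesis by (simp add: matrix_vector_mult_basis column_def)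
  qed
  have "det (A x) \<noteq> 0" using inv[OF assms(2)] by (simp add: invertible_det_nz)
  moreover have "(\<lambda>y. det (\<chi> i j. if j = l then axis s 1 $ i else A y $ i $ j)) differentiable (at x)"
  proof (rule differentiable_det)
    show "(\<lambda>y. (\<chi> i j. if j = l then axis s 1 $ i else A y $ i $ j) $ i' $ j') differentiable (at x)" for i' j'
      by (cases "j' = l") (simp_all add: d)
  qed
  ultimately have "?c differentiable (at x)"
    by (intro differentiable_divide differentiable_det[of A] d)
  then show ?thesis
    by (rule differentiable_transform_open[OF _ assms(1,2) eq])
qed

section \<open>Curvature of the warped metric in product coordinates\<close>

text \<open>The metric \<open>G\<close> is \<open>\<phi>\<^sup>-\<^sup>2 diag(\<epsilon>) \<oplus> f\<^sup>2 H\<close> in product coordinates, with \<open>\<phi>\<close> and \<open>f\<close> functions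
  of the height. The data are carried by the logarithmic derivatives \<open>p = \<phi>' / \<phi>\<close> and
  \<open>L = f' / f\<close>, in which the Christoffel symbols and the scalar curvature become
  polynomial.\<close>

locale warped_block =
  fixes \<epsilon> :: "'n::finite \<Rightarrow> real" and \<alpha> :: "real^'n" and \<phi> f p L p' L' :: "real \<Rightarrow> real"
    and H :: "real^'m::finite \<Rightarrow> real^'m^'m" and U :: "(real^'m) set"
    and G :: "real^('n + 'm) \<Rightarrow> real^('n + 'm)^('n + 'm)"
  assumes eps_square: "\<epsilon> a * \<epsilon> a = 1"
    and \<phi>_nonzero: "\<phi> t \<noteq> 0" and f_nonzero: "f t \<noteq> 0"
    and \<phi>_deriv: "(\<phi> has_real_derivative p t * \<phi> t) (at t)"
    and f_deriv: "(f has_real_derivative L t * f t) (at t)"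
    and p_deriv: "(p has_real_derivative p' t) (at t)"
    and L_deriv: "(L has_real_derivative L' t) (at t)"
    and open_U: "open U"
    and H_sym: "y \<in> U \<Longrightarrow> transpose (H y) = H y"
    and H_inv: "y \<in> U \<Longrightarrow> invertible (H y)"
    and H_diff: "y \<in> U \<Longrightarrow> (\<lambda>y. H y $ i $ j) differentiable (at y)"
    and christoffel_diff: "y \<in> U \<Longrightarrow> christoffel H l i j differentiable (at y)"
    and G_block: "fibre_part z \<in> U \<Longrightarrow>
      G z = block_diag ((1 / (\<phi> (height \<alpha> z))\<^sup>2) *\<^sub>R (\<chi> a b. if a = b then \<epsilon> a else 0))
              ((f (height \<alpha> z))\<^sup>2 *\<^sub>R H (fibre_part z))"
begin

text \<open>\<open>U\<close> is the coordinate domain of a chart of the fibre, and \<open>chart_region\<close> that of the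
  corresponding product chart.\<close>

definition chart_region :: "(real^('n + 'm)) set" where "chart_region = fibre_part -` U"

text \<open>The Christoffel symbols of the conformally flat base are \<open>- p\<close> times these constants, so
  derivatives of the symbols only see \<open>p\<close>.\<close>

definition conf_coeff :: "'n \<Rightarrow> 'n \<Rightarrow> 'n \<Rightarrow> real" where
  "conf_coeff c a b = (if b = c then \<alpha> $ a else 0) + (if a = c then \<alpha> $ b else 0)
     - (if a = b then \<epsilon> a * \<epsilon> c * \<alpha> $ c else 0)"

text \<open>This is \<open>g(\<nabla>\<xi>, \<nabla>\<xi>)\<close> for the flat metric \<open>g\<close>.\<close>

definition grad_sq :: real where "grad_sq = (\<Sum>a\<in>UNIV. \<epsilon> a * (\<alpha> $ a)\<^sup>2)"

lemma open_chart_region: "open chart_region"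
  unfolding chart_region_def
  by (rule open_vimage[OF open_U]) (simp add: linear_continuous_on bounded_linear_fibre_part)

lemma G_simps:
  assumes "z \<in> chart_region"
  shows "G z $ Inl a $ Inl b = (\<phi> (height \<alpha> z) powi - 2) * (if a = b then \<epsilon> a else 0)"
    "G z $ Inl a $ Inr j = 0" "G z $ Inr i $ Inl b = 0"
    "G z $ Inr i $ Inr j = (f (height \<alpha> z))\<^sup>2 * H (fibre_part z) $ i $ j"
  using assms by (auto simp: chart_region_def G_block block_diag_def power_int_def divide_simps)

lemma pd_separated:
  assumes "z \<in> chart_region" "\<And>w. w \<in> chart_region \<Longrightarrow> g w = u (height \<alpha> w) * v (fibre_part w)"
    and "(u has_real_derivative u') (at (height \<alpha> z))" "v differentiable (at (fibre_part z))"
  shows "pd (Inl a) g z = u' * \<alpha> $ a * v (fibre_part z)"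
    "pd (Inr b) g z = u (height \<alpha> z) * pd b v (fibre_part z)"
  using pd_cong_on_open[OF open_chart_region assms(1,2)] separated_derivative[OF assms(3,4)] by auto

lemma pd_zero_on_chart_region:
  assumes "z \<in> chart_region" "\<And>w. w \<in> chart_region \<Longrightarrow> g w = 0"
  shows "pd k g z = 0"
  using pd_cong_on_open[OF open_chart_region assms(1), of g "\<lambda>_. 0"] assms(2) by simp

lemma pd_function_of_height:
  assumes "z \<in> chart_region" "\<And>w. w \<in> chart_region \<Longrightarrow> g w = u (height \<alpha> w) * c"
    and "(u has_real_derivative u') (at (height \<alpha> z))"
  shows "pd (Inl a) g z = u' * \<alpha> $ a * c" "pd (Inr b) g z = 0"
  using pd_separated[OF assms(1), of g u "\<lambda>_. c", OF assms(2,3)] by simp_all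

lemma pd_function_of_fibre:
  assumes "z \<in> chart_region" "\<And>w. w \<in> chart_region \<Longrightarrow> g w = v (fibre_part w)"
    and "v differentiable (at (fibre_part z))"
  shows "pd (Inl a) g z = 0" "pd (Inr b) g z = pd b v (fibre_part z)"
  using pd_separated[OF assms(1), of g "\<lambda>_. 1" v 0, OF _ _ assms(3)] assms(2) by simp_all

lemma inv_square_deriv:
  "((\<lambda>t. \<phi> t powi - 2) has_real_derivative - 2 * p t * \<phi> t powi - 2) (at t)"
  using \<phi>_nonzero[of t]
  by (auto intro!: derivative_eq_intros \<phi>_deriv simp: power_int_def field_simps power2_eq_square power_Suc numeral_3_eq_3)

lemma f_square_deriv: "((\<lambda>t. (f t)\<^sup>2) has_real_derivative 2 * L t * (f t)\<^sup>2) (at t)"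
  by (auto intro!: derivative_eq_intros f_deriv simp: power2_eq_square)

lemma pd_G:
  assumes z: "z \<in> chart_region"
  shows "pd (Inl d) (\<lambda>w. G w $ Inl a $ Inl b) z
      = - 2 * p (height \<alpha> z) * \<phi> (height \<alpha> z) powi - 2 * \<alpha> $ d * (if a = b then \<epsilon> a else 0)"
    "pd (Inr k) (\<lambda>w. G w $ Inl a $ Inl b) z = 0"
    "pd s (\<lambda>w. G w $ Inl a $ Inr j) z = 0"
    "pd s (\<lambda>w. G w $ Inr j $ Inl a) z = 0"
    "pd (Inl d) (\<lambda>w. G w $ Inr i $ Inr j) z
      = 2 * L (height \<alpha> z) * (f (height \<alpha> z))\<^sup>2 * \<alpha> $ d * H (fibre_part z) $ i $ j"
    "pd (Inr k) (\<lambda>w. G w $ Inr i $ Inr j) z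
      = (f (height \<alpha> z))\<^sup>2 * pd k (\<lambda>y. H y $ i $ j) (fibre_part z)"
proof -
  have y: "fibre_part z \<in> U" using z by (simp add: chart_region_def)
  show "pd (Inl d) (\<lambda>w. G w $ Inl a $ Inl b) z
      = - 2 * p (height \<alpha> z) * \<phi> (height \<alpha> z) powi - 2 * \<alpha> $ d * (if a = b then \<epsilon> a else 0)"
    "pd (Inr k) (\<lambda>w. G w $ Inl a $ Inl b) z = 0"
    by (rule pd_function_of_height[OF z G_simps(1) inv_square_deriv]; assumption)+
  show "pd s (\<lambda>w. G w $ Inl a $ Inr j) z = 0" "pd s (\<lambda>w. G w $ Inr j $ Inl a) z = 0"
    by (rule pd_zero_on_chart_region[OF z]; simp add: G_simps)+
  show "pd (Inl d) (\<lambda>w. G w $ Inr i $ Inr j) z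
      = 2 * L (height \<alpha> z) * (f (height \<alpha> z))\<^sup>2 * \<alpha> $ d * H (fibre_part z) $ i $ j"
    "pd (Inr k) (\<lambda>w. G w $ Inr i $ Inr j) z
      = (f (height \<alpha> z))\<^sup>2 * pd k (\<lambda>y. H y $ i $ j) (fibre_part z)"
    by (rule pd_separated[OF z G_simps(4) f_square_deriv H_diff[OF y]]; assumption)+
qed

lemma G_inverse_simps:
  assumes "z \<in> chart_region"
  shows "matrix_inv (G z) $ Inl a $ Inl b = (\<phi> (height \<alpha> z))\<^sup>2 * (if a = b then \<epsilon> a else 0)"
    "matrix_inv (G z) $ Inl a $ Inr j = 0" "matrix_inv (G z) $ Inr i $ Inl b = 0"
    "matrix_inv (G z) $ Inr i $ Inr j
      = matrix_inv (H (fibre_part z)) $ i $ j / (f (height \<alpha> z))\<^sup>2"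
proof -
  have y: "fibre_part z \<in> U" using assms by (simp add: chart_region_def)
  let ?E = "(\<chi> a b. if a = b then \<epsilon> a else 0) :: real^'n^'n"
  have E: "?E ** ?E = mat 1"
    by (simp add: matrix_matrix_mult_def mat_def vec_eq_iff eps_square if_distrib[of "\<lambda>x. _ * x"] cong: if_cong)
  have "((1 / (\<phi> (height \<alpha> z))\<^sup>2) *\<^sub>R ?E) ** ((\<phi> (height \<alpha> z))\<^sup>2 *\<^sub>R ?E) = mat 1"
    using \<phi>_nonzero by (simp add: matrix_scalar_ac scalar_matrix_assoc E)
  moreover have "((f (height \<alpha> z))\<^sup>2 *\<^sub>R H (fibre_part z)) **
      ((1 / (f (height \<alpha> z))\<^sup>2) *\<^sub>R matrix_inv (H (fibre_part z))) = mat 1"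
    using f_nonzero by (simp add: matrix_scalar_ac scalar_matrix_assoc matrix_inv_inverse(1)[OF H_inv[OF y]])
  ultimately have "matrix_inv (G z) = block_diag ((\<phi> (height \<alpha> z))\<^sup>2 *\<^sub>R ?E)
      ((1 / (f (height \<alpha> z))\<^sup>2) *\<^sub>R matrix_inv (H (fibre_part z)))"
    unfolding G_block[OF y] by (rule matrix_inv_block_diag)
  then show "matrix_inv (G z) $ Inl a $ Inl b = (\<phi> (height \<alpha> z))\<^sup>2 * (if a = b then \<epsilon> a else 0)"
    "matrix_inv (G z) $ Inl a $ Inr j = 0" "matrix_inv (G z) $ Inr i $ Inl b = 0"
    "matrix_inv (G z) $ Inr i $ Inr j
      = matrix_inv (H (fibre_part z)) $ i $ j / (f (height \<alpha> z))\<^sup>2"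
    by (simp_all add: block_diag_def)
qed

lemma H_inverse_entries:
  assumes "y \<in> U"
  shows "(\<Sum>s\<in>UNIV. matrix_inv (H y) $ k $ s * H y $ i $ s) = (if k = i then 1 else 0)"
    "(\<Sum>s\<in>UNIV. matrix_inv (H y) $ k $ s * H y $ s $ i) = (if k = i then 1 else 0)"
proof -
  show *: "(\<Sum>s\<in>UNIV. matrix_inv (H y) $ k $ s * H y $ s $ i) = (if k = i then 1 else 0)" for k i
    using matrix_inv_inverse(2)[OF H_inv[OF assms]]
    by (auto simp: matrix_matrix_mult_def mat_def vec_eq_iff)
  have "H y $ i $ s = H y $ s $ i" for s
    using H_sym[OF assms] by (metis transpose_def vec_lambda_beta)
  then show "(\<Sum>s\<in>UNIV. matrix_inv (H y) $ k $ s * H y $ i $ s) = (if k = i then 1 else 0)"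
    using * by simp
qed

lemma christoffel_G:
  assumes z: "z \<in> chart_region"
  shows "christoffel G (Inl c) (Inl a) (Inl b) z = - p (height \<alpha> z) * conf_coeff c a b"
    "christoffel G (Inl c) (Inl a) (Inr i) z = 0" "christoffel G (Inl c) (Inr i) (Inl a) z = 0"
    "christoffel G (Inl c) (Inr i) (Inr j) z
      = - ((\<phi> (height \<alpha> z))\<^sup>2 * (f (height \<alpha> z))\<^sup>2 * L (height \<alpha> z)) * (\<epsilon> c * \<alpha> $ c * H (fibre_part z) $ i $ j)"
    "christoffel G (Inr k) (Inl a) (Inl b) z = 0"
    "christoffel G (Inr k) (Inl a) (Inr i) z = L (height \<alpha> z) * (if k = i then \<alpha> $ a else 0)"
    "christoffel G (Inr k) (Inr i) (Inl a) z = L (height \<alpha> z) * (if k = i then \<alpha> $ a else 0)"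
    "christoffel G (Inr k) (Inr i) (Inr j) z = christoffel H k i j (fibre_part z)"
proof -
  have y: "fibre_part z \<in> U" using z by (simp add: chart_region_def)
  have P: "(\<phi> (height \<alpha> z))\<^sup>2 * (\<phi> (height \<alpha> z) powi - 2) = 1"
    using \<phi>_nonzero[of "height \<alpha> z"] by (simp add: power_int_def power_inverse)
  have F: "f (height \<alpha> z) \<noteq> 0" by (rule f_nonzero)
  show "christoffel G (Inl c) (Inl a) (Inr i) z = 0" "christoffel G (Inl c) (Inr i) (Inl a) z = 0"
    "christoffel G (Inr k) (Inl a) (Inl b) z = 0"
    by (simp_all add: christoffel_def sum_UNIV_Plus pd_G[OF z] G_inverse_simps[OF z])
  show "christoffel G (Inl c) (Inl a) (Inl b) z = - p (height \<alpha> z) * conf_coeff c a b"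
  proof -
    have "christoffel G (Inl c) (Inl a) (Inl b) z = - ((\<phi> (height \<alpha> z))\<^sup>2 * (\<phi> (height \<alpha> z) powi - 2))
       * p (height \<alpha> z) * (\<epsilon> c * ((if b = c then \<epsilon> b * \<alpha> $ a else 0) + (if a = c then \<epsilon> a * \<alpha> $ b else 0)
         - (if a = b then \<epsilon> a * \<alpha> $ c else 0)))"
      by (simp add: christoffel_def sum_UNIV_Plus pd_G[OF z] G_inverse_simps[OF z]
          if_distrib[of "\<lambda>x. x * _"] if_distrib[of "\<lambda>x. _ * x"] cong: if_cong)
    also have "\<dots> = - p (height \<alpha> z) * conf_coeff c a b"
      unfolding P conf_coeff_def using eps_square by (auto simp: algebra_simps)
    finally show ?thesis .
  qed
  show "christoffel G (Inl c) (Inr i) (Inr j) z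
      = - ((\<phi> (height \<alpha> z))\<^sup>2 * (f (height \<alpha> z))\<^sup>2 * L (height \<alpha> z)) * (\<epsilon> c * \<alpha> $ c * H (fibre_part z) $ i $ j)"
    by (simp add: christoffel_def sum_UNIV_Plus pd_G[OF z] G_inverse_simps[OF z] sum_negf
          if_distrib[of "\<lambda>x. x * _"] if_distrib[of "\<lambda>x. _ * x"] cong: if_cong)
  have *: "(\<Sum>s\<in>UNIV. matrix_inv (H (fibre_part z)) $ k $ s / (f (height \<alpha> z))\<^sup>2 *
      (2 * L (height \<alpha> z) * (f (height \<alpha> z))\<^sup>2 * \<alpha> $ a * H (fibre_part z) $ i $ s)) / 2
     = L (height \<alpha> z) * (if k = i then \<alpha> $ a else 0)"
  proof -
    have "(\<Sum>s\<in>UNIV. matrix_inv (H (fibre_part z)) $ k $ s / (f (height \<alpha> z))\<^sup>2 *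
      (2 * L (height \<alpha> z) * (f (height \<alpha> z))\<^sup>2 * \<alpha> $ a * H (fibre_part z) $ i $ s))
     = (\<Sum>s\<in>UNIV. 2 * L (height \<alpha> z) * \<alpha> $ a * (matrix_inv (H (fibre_part z)) $ k $ s * H (fibre_part z) $ i $ s))"
      using F by (intro sum.cong refl) (simp add: field_simps)
    also have "\<dots> = 2 * L (height \<alpha> z) * \<alpha> $ a * (if k = i then 1 else 0)"
      unfolding sum_distrib_left[symmetric] H_inverse_entries[OF y] ..
    finally show ?thesis by auto
  qed
  then show "christoffel G (Inr k) (Inl a) (Inr i) z = L (height \<alpha> z) * (if k = i then \<alpha> $ a else 0)"
    "christoffel G (Inr k) (Inr i) (Inl a) z = L (height \<alpha> z) * (if k = i then \<alpha> $ a else 0)"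
    by (simp_all add: christoffel_def sum_UNIV_Plus pd_G[OF z] G_inverse_simps[OF z])
  show "christoffel G (Inr k) (Inr i) (Inr j) z = christoffel H k i j (fibre_part z)"
    using F
    by (simp add: christoffel_def sum_UNIV_Plus pd_G[OF z] G_inverse_simps[OF z] algebra_simps)
qed

text \<open>Only the derivatives that enter the diagonal base components and the fibre components of
  the Ricci tensor are listed; since the inverse metric is block diagonal and diagonal on the
  base, the scalar curvature needs no others.\<close>

lemma pd_christoffel_G:
  assumes z: "z \<in> chart_region"
  shows "pd (Inl d) (christoffel G (Inl c) (Inl a) (Inl b)) z = - p' (height \<alpha> z) * \<alpha> $ d * conf_coeff c a b"
    "pd s (christoffel G (Inl c) (Inl a) (Inr i)) z = 0"
    "pd s (christoffel G (Inl c) (Inr i) (Inl a)) z = 0"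
    "pd (Inl d) (christoffel G (Inl c) (Inr i) (Inr j)) z
      = - ((\<phi> (height \<alpha> z))\<^sup>2 * (f (height \<alpha> z))\<^sup>2 * (2 * p (height \<alpha> z) * L (height \<alpha> z)
          + 2 * (L (height \<alpha> z))\<^sup>2 + L' (height \<alpha> z)))
        * \<alpha> $ d * (\<epsilon> c * \<alpha> $ c * H (fibre_part z) $ i $ j)"
    "pd s (christoffel G (Inr k) (Inl a) (Inl b)) z = 0"
    "pd (Inl d) (christoffel G (Inr k) (Inr i) (Inl a)) z
      = L' (height \<alpha> z) * \<alpha> $ d * (if k = i then \<alpha> $ a else 0)"
    "pd (Inr l) (christoffel G (Inr k) (Inr i) (Inr j)) z = pd l (christoffel H k i j) (fibre_part z)"
proof -
  have y: "fibre_part z \<in> U" using z by (simp add: chart_region_def)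
  have "((\<lambda>t. - p t) has_real_derivative - p' t) (at t)" for t
    by (intro derivative_intros p_deriv)
  from pd_function_of_height(1)[OF z christoffel_G(1) this]
  show "pd (Inl d) (christoffel G (Inl c) (Inl a) (Inl b)) z = - p' (height \<alpha> z) * \<alpha> $ d * conf_coeff c a b"
    by simp
  show "pd s (christoffel G (Inl c) (Inl a) (Inr i)) z = 0"
    "pd s (christoffel G (Inl c) (Inr i) (Inl a)) z = 0"
    "pd s (christoffel G (Inr k) (Inl a) (Inl b)) z = 0"
    by (rule pd_zero_on_chart_region[OF z]; simp add: christoffel_G)+
  have d: "((\<lambda>t. - ((\<phi> t)\<^sup>2 * (f t)\<^sup>2 * L t)) has_real_derivative
      - ((\<phi> t)\<^sup>2 * (f t)\<^sup>2 * (2 * p t * L t + 2 * (L t)\<^sup>2 + L' t))) (at t)" for t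
    by (auto intro!: derivative_eq_intros \<phi>_deriv f_deriv L_deriv simp: power2_eq_square algebra_simps)
  show "pd (Inl d) (christoffel G (Inl c) (Inr i) (Inr j)) z
      = - ((\<phi> (height \<alpha> z))\<^sup>2 * (f (height \<alpha> z))\<^sup>2 * (2 * p (height \<alpha> z) * L (height \<alpha> z)
          + 2 * (L (height \<alpha> z))\<^sup>2 + L' (height \<alpha> z)))
        * \<alpha> $ d * (\<epsilon> c * \<alpha> $ c * H (fibre_part z) $ i $ j)"
    by (rule pd_separated(1)[OF z christoffel_G(4) d])
       (auto intro: differentiable_mult H_diff[OF y])
  show "pd (Inl d) (christoffel G (Inr k) (Inr i) (Inl a)) z
      = L' (height \<alpha> z) * \<alpha> $ d * (if k = i then \<alpha> $ a else 0)"
    by (rule pd_function_of_height(1)[OF z christoffel_G(7) L_deriv])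
  show "pd (Inr l) (christoffel G (Inr k) (Inr i) (Inr j)) z = pd l (christoffel H k i j) (fibre_part z)"
    by (rule pd_function_of_fibre(2)[OF z christoffel_G(8) christoffel_diff[OF y]])
qed

lemma eps_cancel: "\<epsilon> a * (\<epsilon> a * x) = x"
  using eps_square[of a] by (simp add: mult.assoc[symmetric])

text \<open>These are the four sums over base indices that the Ricci tensor requires.\<close>

lemma conf_coeff_contractions:
  shows "(\<Sum>c\<in>UNIV. conf_coeff c c d) = real CARD('n) * \<alpha> $ d"
    "(\<Sum>c\<in>UNIV. \<alpha> $ c * conf_coeff c a a) = 2 * (\<alpha> $ a)\<^sup>2 - \<epsilon> a * grad_sq"
    "(\<Sum>c\<in>UNIV. \<Sum>d\<in>UNIV. conf_coeff c c d * conf_coeff d a a) = real CARD('n) * (2 * (\<alpha> $ a)\<^sup>2 - \<epsilon> a * grad_sq)"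
    "(\<Sum>c\<in>UNIV. \<Sum>d\<in>UNIV. conf_coeff c a d * conf_coeff d c a) = (real CARD('n) + 2) * (\<alpha> $ a)\<^sup>2 - 2 * \<epsilon> a * grad_sq"
proof -
  show 1: "(\<Sum>c\<in>UNIV. conf_coeff c c d) = real CARD('n) * \<alpha> $ d" for d
  proof -
    have "conf_coeff c c d = \<alpha> $ d" for c
      using eps_square[of c] by (auto simp: conf_coeff_def)
    then show ?thesis by simp
  qed
  show 2: "(\<Sum>c\<in>UNIV. \<alpha> $ c * conf_coeff c a a) = 2 * (\<alpha> $ a)\<^sup>2 - \<epsilon> a * grad_sq"
  proof -
    have "\<alpha> $ c * conf_coeff c a a = (if a = c then 2 * (\<alpha> $ a)\<^sup>2 else 0) - \<epsilon> a * (\<epsilon> c * (\<alpha> $ c)\<^sup>2)" for c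
      by (auto simp: conf_coeff_def power2_eq_square algebra_simps)
    then show ?thesis by (simp add: sum_subtractf grad_sq_def sum_distrib_left[symmetric])
  qed
  have "(\<Sum>c\<in>UNIV. \<Sum>d\<in>UNIV. conf_coeff c c d * conf_coeff d a a) = (\<Sum>d\<in>UNIV. (\<Sum>c\<in>UNIV. conf_coeff c c d) * conf_coeff d a a)"
    by (subst sum.swap) (simp add: sum_distrib_right)
  also have "\<dots> = real CARD('n) * (\<Sum>d\<in>UNIV. \<alpha> $ d * conf_coeff d a a)"
    by (simp add: 1 sum_distrib_left mult.assoc)
  finally show "(\<Sum>c\<in>UNIV. \<Sum>d\<in>UNIV. conf_coeff c c d * conf_coeff d a a) = real CARD('n) * (2 * (\<alpha> $ a)\<^sup>2 - \<epsilon> a * grad_sq)"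
    by (simp add: 2)
  have "conf_coeff c a d * conf_coeff d c a = (if d = c then (\<alpha> $ a)\<^sup>2 else 0)
      + (if a = c then (if a = d then 2 * (\<alpha> $ a)\<^sup>2 else 0) else 0)
      - (if a = c then \<epsilon> a * (\<epsilon> d * (\<alpha> $ d)\<^sup>2) else 0)
      - (if a = d then \<epsilon> a * (\<epsilon> c * (\<alpha> $ c)\<^sup>2) else 0)" for c d
    by (auto simp: conf_coeff_def power2_eq_square algebra_simps eps_cancel)
  then have "(\<Sum>c\<in>UNIV. \<Sum>d\<in>UNIV. conf_coeff c a d * conf_coeff d c a) =
      (\<Sum>c\<in>(UNIV :: 'n set). \<Sum>d\<in>(UNIV :: 'n set). if d = c then (\<alpha> $ a)\<^sup>2 else 0)
      + (\<Sum>c\<in>(UNIV :: 'n set). \<Sum>d\<in>(UNIV :: 'n set). if a = c then (if a = d then 2 * (\<alpha> $ a)\<^sup>2 else 0) else 0)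
      - (\<Sum>c\<in>(UNIV :: 'n set). \<Sum>d\<in>(UNIV :: 'n set). if a = c then \<epsilon> a * (\<epsilon> d * (\<alpha> $ d)\<^sup>2) else 0)
      - (\<Sum>c\<in>(UNIV :: 'n set). \<Sum>d\<in>(UNIV :: 'n set). if a = d then \<epsilon> a * (\<epsilon> c * (\<alpha> $ c)\<^sup>2) else 0)"
    by (simp only: sum.distrib sum_subtractf)
  moreover have "(\<Sum>c\<in>(UNIV :: 'n set). \<Sum>d\<in>(UNIV :: 'n set). if a = c then (if a = d then 2 * (\<alpha> $ a)\<^sup>2 else 0) else 0)
      = 2 * (\<alpha> $ a)\<^sup>2"
    by (subst sum.swap) simp
  moreover have "(\<Sum>c\<in>(UNIV :: 'n set). \<Sum>d\<in>(UNIV :: 'n set). if a = c then \<epsilon> a * (\<epsilon> d * (\<alpha> $ d)\<^sup>2) else 0) = \<epsilon> a * grad_sq"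
    by (subst sum.swap) (simp add: grad_sq_def sum_distrib_left)
  moreover have "(\<Sum>c\<in>(UNIV :: 'n set). \<Sum>d\<in>(UNIV :: 'n set). if a = d then \<epsilon> a * (\<epsilon> c * (\<alpha> $ c)\<^sup>2) else 0) = \<epsilon> a * grad_sq"
    by (simp add: grad_sq_def sum_distrib_left)
  ultimately show "(\<Sum>c\<in>UNIV. \<Sum>d\<in>UNIV. conf_coeff c a d * conf_coeff d c a) = (real CARD('n) + 2) * (\<alpha> $ a)\<^sup>2 - 2 * \<epsilon> a * grad_sq"
    by (simp add: algebra_simps)
qed

lemma ricci_G_base:
  assumes z: "z \<in> chart_region"
  shows "ricci_coord G (Inl a) (Inl a) z =
    - p' (height \<alpha> z) * (2 * (\<alpha> $ a)\<^sup>2 - \<epsilon> a * grad_sq) + p' (height \<alpha> z) * (real CARD('n) * (\<alpha> $ a)\<^sup>2)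
    + (p (height \<alpha> z))\<^sup>2 * (real CARD('n) * (2 * (\<alpha> $ a)\<^sup>2 - \<epsilon> a * grad_sq)
        - ((real CARD('n) + 2) * (\<alpha> $ a)\<^sup>2 - 2 * \<epsilon> a * grad_sq))
    - real CARD('m) * ((L' (height \<alpha> z) + (L (height \<alpha> z))\<^sup>2) * (\<alpha> $ a)\<^sup>2
        + p (height \<alpha> z) * L (height \<alpha> z) * (2 * (\<alpha> $ a)\<^sup>2 - \<epsilon> a * grad_sq))"
proof -
  let ?p = "p (height \<alpha> z)" and ?p' = "p' (height \<alpha> z)" and ?L = "L (height \<alpha> z)" and ?L' = "L' (height \<alpha> z)"
  have "(\<Sum>c\<in>UNIV. riemann_coord G (Inl c) (Inl a) (Inl c) (Inl a) z)
      = (\<Sum>c\<in>UNIV. - ?p' * (\<alpha> $ c * conf_coeff c a a) + ?p' * \<alpha> $ a * conf_coeff c c a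
          + ?p\<^sup>2 * ((\<Sum>d\<in>UNIV. conf_coeff c c d * conf_coeff d a a) - (\<Sum>d\<in>UNIV. conf_coeff c a d * conf_coeff d c a)))"
    by (intro sum.cong refl)
       (simp add: riemann_coord_def sum_UNIV_Plus christoffel_G[OF z] pd_christoffel_G[OF z]
          sum_subtractf sum_distrib_left power2_eq_square algebra_simps)
  also have "\<dots> = - ?p' * (\<Sum>c\<in>UNIV. \<alpha> $ c * conf_coeff c a a) + ?p' * \<alpha> $ a * (\<Sum>c\<in>UNIV. conf_coeff c c a)
     + ?p\<^sup>2 * ((\<Sum>c\<in>UNIV. \<Sum>d\<in>UNIV. conf_coeff c c d * conf_coeff d a a) - (\<Sum>c\<in>UNIV. \<Sum>d\<in>UNIV. conf_coeff c a d * conf_coeff d c a))"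
    by (simp only: sum.distrib sum_subtractf sum_distrib_left[symmetric])
  finally have 1: "(\<Sum>c\<in>UNIV. riemann_coord G (Inl c) (Inl a) (Inl c) (Inl a) z) = \<dots>" .
  have fib: "riemann_coord G (Inr k) (Inl a) (Inr k) (Inl a) z
      = - ((?L' + ?L\<^sup>2) * (\<alpha> $ a)\<^sup>2 + ?p * ?L * (\<Sum>d\<in>UNIV. \<alpha> $ d * conf_coeff d a a))" for k
    by (simp add: riemann_coord_def sum_UNIV_Plus christoffel_G[OF z] pd_christoffel_G[OF z]
          sum_subtractf sum_distrib_left power2_eq_square algebra_simps sum_negf
          if_distrib[of "\<lambda>x. x * _"] if_distrib[of "\<lambda>x. _ * x"] cong: if_cong)
  have 2: "(\<Sum>k\<in>UNIV. riemann_coord G (Inr k) (Inl a) (Inr k) (Inl a) z)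
      = - real CARD('m) * ((?L' + ?L\<^sup>2) * (\<alpha> $ a)\<^sup>2 + ?p * ?L * (\<Sum>d\<in>UNIV. \<alpha> $ d * conf_coeff d a a))"
    unfolding fib by (simp add: algebra_simps)
  show ?thesis
    unfolding ricci_coord_def sum_UNIV_Plus 1 2 conf_coeff_contractions
    by (simp add: power2_eq_square algebra_simps)
qed

text \<open>The terms built from fibre indices alone reassemble to the Ricci tensor of \<open>H\<close>. What
  remains is a multiple of \<open>H\<close>, since every other contribution comes from
  \<open>\<Gamma>\<^sup>c\<^bsub>ij\<^esub>\<close>, which is proportional to \<open>H\<^bsub>ij\<^esub>\<close>, or from
  \<open>\<Gamma>\<^sup>k\<^bsub>ai\<^esub>\<close>, which is proportional to the identity.\<close>

lemma ricci_G_fibre: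
  assumes z: "z \<in> chart_region"
  shows "ricci_coord G (Inr i) (Inr j) z = ricci_coord H i j (fibre_part z)
    + grad_sq * (\<phi> (height \<alpha> z))\<^sup>2 * (f (height \<alpha> z))\<^sup>2 *
      ((real CARD('n) - 2) * p (height \<alpha> z) * L (height \<alpha> z)
        - real CARD('m) * (L (height \<alpha> z))\<^sup>2 - L' (height \<alpha> z)) * H (fibre_part z) $ i $ j"
proof -
  let ?p = "p (height \<alpha> z)" and ?L = "L (height \<alpha> z)" and ?L' = "L' (height \<alpha> z)"
    and ?P = "(\<phi> (height \<alpha> z))\<^sup>2" and ?F = "(f (height \<alpha> z))\<^sup>2" and ?y = "fibre_part z"
  let ?h = "H ?y $ i $ j"
  have "(\<Sum>c\<in>UNIV. riemann_coord G (Inl c) (Inr j) (Inl c) (Inr i) z)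
      = (\<Sum>c\<in>UNIV. - (?P * ?F * (2 * ?p * ?L + ?L\<^sup>2 + ?L') * ?h) * (\<epsilon> c * (\<alpha> $ c)\<^sup>2)
          + ?p * ?P * ?F * ?L * ?h * (\<Sum>d\<in>UNIV. conf_coeff c c d * (\<epsilon> d * \<alpha> $ d)))"
    by (intro sum.cong refl)
       (simp add: riemann_coord_def sum_UNIV_Plus christoffel_G[OF z] pd_christoffel_G[OF z]
          sum_subtractf sum_distrib_left power2_eq_square algebra_simps sum_negf
          if_distrib[of "\<lambda>x. x * _"] if_distrib[of "\<lambda>x. _ * x"] cong: if_cong)
  also have "\<dots> = - (?P * ?F * (2 * ?p * ?L + ?L\<^sup>2 + ?L') * ?h) * (\<Sum>c\<in>UNIV. \<epsilon> c * (\<alpha> $ c)\<^sup>2)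
      + ?p * ?P * ?F * ?L * ?h * (\<Sum>c\<in>UNIV. \<Sum>d\<in>UNIV. conf_coeff c c d * (\<epsilon> d * \<alpha> $ d))"
    by (simp only: sum.distrib sum_subtractf sum_distrib_left[symmetric])
  also have "(\<Sum>c\<in>UNIV. \<Sum>d\<in>UNIV. conf_coeff c c d * (\<epsilon> d * \<alpha> $ d)) = real CARD('n) * grad_sq"
    by (subst sum.swap)
       (simp add: sum_distrib_right[symmetric] conf_coeff_contractions, simp add: grad_sq_def sum_distrib_left power2_eq_square mult_ac)
  also have "(\<Sum>c\<in>UNIV. \<epsilon> c * (\<alpha> $ c)\<^sup>2) = grad_sq" by (simp add: grad_sq_def)
  finally have 1: "(\<Sum>c\<in>UNIV. riemann_coord G (Inl c) (Inr j) (Inl c) (Inr i) z)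
      = - (?P * ?F * (2 * ?p * ?L + ?L\<^sup>2 + ?L') * ?h) * grad_sq
      + ?p * ?P * ?F * ?L * ?h * (real CARD('n) * grad_sq)" .
  have "riemann_coord G (Inr k) (Inr j) (Inr k) (Inr i) z
      = riemann_coord H k j k i ?y - ?P * ?F * ?L\<^sup>2 * ?h * (\<Sum>d\<in>UNIV. \<epsilon> d * (\<alpha> $ d)\<^sup>2)
         + (if k = i then ?P * ?F * ?L\<^sup>2 * H ?y $ k $ j * (\<Sum>d\<in>UNIV. \<epsilon> d * (\<alpha> $ d)\<^sup>2) else 0)" for k
    by (simp add: riemann_coord_def sum_UNIV_Plus christoffel_G[OF z] pd_christoffel_G[OF z]
          sum_subtractf sum_distrib_left power2_eq_square algebra_simps sum_negf)
  then have 2: "(\<Sum>k\<in>UNIV. riemann_coord G (Inr k) (Inr j) (Inr k) (Inr i) z)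
      = ricci_coord H i j ?y - real CARD('m) * (?P * ?F * ?L\<^sup>2 * ?h * grad_sq) + ?P * ?F * ?L\<^sup>2 * ?h * grad_sq"
    by (simp add: sum.distrib sum_subtractf ricci_coord_def grad_sq_def)
  show ?thesis
    unfolding ricci_coord_def[of G] sum_UNIV_Plus 1 2
    by (simp add: power2_eq_square algebra_simps)
qed

text \<open>Tracing the base components produces \<open>\<Sum> \<epsilon>\<^sub>a \<alpha>\<^sub>a\<^sup>2\<close>, and each summand \<open>\<epsilon>\<^sub>a \<cdot> \<epsilon>\<^sub>a\<close>
  counts a dimension; tracing the fibre components gives the scalar curvature of \<open>H\<close> and a
  factor \<open>m\<close>. Hence everything apart from the fibre term is \<open>grad_sq \<cdot> \<phi>\<^sup>2\<close> times a function of
  the height.\<close>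

lemma scalar_G:
  assumes z: "z \<in> chart_region"
  shows "scalar_coord G z = scalar_coord H (fibre_part z) / (f (height \<alpha> z))\<^sup>2
    + grad_sq * (\<phi> (height \<alpha> z))\<^sup>2 * ((real CARD('n) - 1) * (2 * p' (height \<alpha> z)
          - (real CARD('n) - 2) * (p (height \<alpha> z))\<^sup>2)
        - 2 * real CARD('m) * L' (height \<alpha> z)
        - real CARD('m) * (real CARD('m) + 1) * (L (height \<alpha> z))\<^sup>2
        + 2 * real CARD('m) * (real CARD('n) - 2) * p (height \<alpha> z) * L (height \<alpha> z))"
proof -
  let ?p = "p (height \<alpha> z)" and ?p' = "p' (height \<alpha> z)" and ?L = "L (height \<alpha> z)" and ?L' = "L' (height \<alpha> z)"
    and ?P = "(\<phi> (height \<alpha> z))\<^sup>2" and ?F = "(f (height \<alpha> z))\<^sup>2" and ?y = "fibre_part z"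
  let ?n = "real CARD('n)" and ?m = "real CARD('m)"
  have y: "?y \<in> U" using z by (simp add: chart_region_def)
  have F: "?F \<noteq> 0" using f_nonzero by simp
  have eps1: "(\<Sum>a\<in>UNIV. \<epsilon> a * (\<alpha> $ a)\<^sup>2) = grad_sq" by (simp add: grad_sq_def)
  define A B where "A = - 2 * ?p' + ?n * ?p' + ?p\<^sup>2 * (2 * ?n - (?n + 2)) - ?m * (?L' + ?L\<^sup>2 + 2 * ?p * ?L)"
    and "B = (?p' + ?p\<^sup>2 * (2 - ?n) + ?m * ?p * ?L) * grad_sq"
  have "\<epsilon> a * ricci_coord G (Inl a) (Inl a) z = A * (\<epsilon> a * (\<alpha> $ a)\<^sup>2) + B" for a
  proof -
    have "ricci_coord G (Inl a) (Inl a) z = A * (\<alpha> $ a)\<^sup>2 + \<epsilon> a * B"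
      unfolding ricci_G_base[OF z] A_def B_def by (simp add: algebra_simps)
    then show ?thesis using eps_square[of a] by (simp add: algebra_simps)
  qed
  then have 1: "(\<Sum>a\<in>UNIV. \<epsilon> a * ricci_coord G (Inl a) (Inl a) z) = A * grad_sq + ?n * B"
    by (simp add: sum.distrib sum_distrib_left[symmetric] eps1)
  define C where "C = grad_sq * ?P * ((?n - 2) * ?p * ?L - ?m * ?L\<^sup>2 - ?L')"
  have "matrix_inv (H ?y) $ i $ j / ?F * ricci_coord G (Inr i) (Inr j) z
      = matrix_inv (H ?y) $ i $ j * ricci_coord H i j ?y / ?F + C * (matrix_inv (H ?y) $ i $ j * H ?y $ i $ j)" for i j
    unfolding ricci_G_fibre[OF z] C_def using F by (simp add: field_simps)
  then have 2: "(\<Sum>i\<in>UNIV. \<Sum>j\<in>UNIV. matrix_inv (H ?y) $ i $ j / ?F * ricci_coord G (Inr i) (Inr j) z)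
      = scalar_coord H ?y / ?F + C * ?m"
    by (simp add: sum.distrib sum_divide_distrib[symmetric] sum_distrib_left[symmetric] scalar_coord_def
        H_inverse_entries[OF y])
  have "scalar_coord G z = ?P * (\<Sum>a\<in>UNIV. \<epsilon> a * ricci_coord G (Inl a) (Inl a) z)
      + (\<Sum>i\<in>UNIV. \<Sum>j\<in>UNIV. matrix_inv (H ?y) $ i $ j / ?F * ricci_coord G (Inr i) (Inr j) z)"
    by (simp add: scalar_coord_def sum_UNIV_Plus G_inverse_simps[OF z] sum_distrib_left mult.assoc
        if_distrib[of "\<lambda>x. x * _"] if_distrib[of "\<lambda>x. _ * x"] cong: if_cong)
  then show ?thesis
    unfolding 1 2 A_def B_def C_def by (simp add: power2_eq_square algebra_simps)
qed

end

section \<open>Profiles of smooth functions\<close>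

lemma has_derivative_along_line:
  fixes f :: "'a::real_normed_vector \<Rightarrow> real"
  assumes "f differentiable (at (t *\<^sub>R w))"
  shows "((\<lambda>s. f (s *\<^sub>R w)) has_real_derivative frechet_derivative f (at (t *\<^sub>R w)) w) (at t)"
proof -
  let ?D = "frechet_derivative f (at (t *\<^sub>R w))"
  have D: "(f has_derivative ?D) (at (t *\<^sub>R w))"
    using assms frechet_derivative_works by blast
  have "((\<lambda>s. s *\<^sub>R w) has_derivative (\<lambda>s. s *\<^sub>R w)) (at t)"
    by (auto intro!: derivative_eq_intros)
  from has_derivative_compose[OF this D]
  have "((\<lambda>s. f (s *\<^sub>R w)) has_derivative (\<lambda>s. ?D (s *\<^sub>R w))) (at t)" .
  moreover have "?D (s *\<^sub>R w) = ?D w * s" for s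
    using linear_cmul[OF has_derivative_linear[OF D]] by simp
  ultimately show ?thesis
    unfolding has_field_derivative_def by simp
qed

text \<open>The profile \<open>f1\<close> of a function \<open>f\<close> of the height is the restriction of \<open>f\<close> to a line
  transversal to the level hyperplanes, so it inherits the regularity of \<open>f\<close>.\<close>

lemma smooth_profile_derivatives:
  fixes f :: "'a::real_normed_vector \<Rightarrow> real"
  assumes f: "smooth_on UNIV f" and f1: "\<And>t. f1 t = f (t *\<^sub>R w)"
  shows "(f1 has_real_derivative deriv f1 t) (at t)"
    "(deriv f1 has_real_derivative deriv (deriv f1) t) (at t)"
proof -
  have C2: "Ck_on (Suc (Suc 0)) UNIV f" using f by (simp add: smooth_on_def del: Ck_on.simps)
  let ?D = "\<lambda>x. frechet_derivative f (at x) w"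
  have f1_eq: "f1 = (\<lambda>t. f (t *\<^sub>R w))" using f1 by auto
  have 1: "(f1 has_real_derivative ?D (t *\<^sub>R w)) (at t)" for t
    unfolding f1_eq by (rule has_derivative_along_line) (use C2 in simp)
  then have d: "deriv f1 = (\<lambda>t. ?D (t *\<^sub>R w))"
    using DERIV_imp_deriv by blast
  show "(f1 has_real_derivative deriv f1 t) (at t)"
    unfolding d by (rule 1)
  have 2: "(deriv f1 has_real_derivative frechet_derivative ?D (at (t *\<^sub>R w)) w) (at t)"
    unfolding d by (rule has_derivative_along_line) (use C2 in simp)
  then show "(deriv f1 has_real_derivative deriv (deriv f1) t) (at t)"
    by (simp add: DERIV_imp_deriv)
qed

section \<open>The Riccati equation\<close>

definition log_deriv :: "(real \<Rightarrow> real) \<Rightarrow> real \<Rightarrow> real" where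
  "log_deriv u t = deriv u t / u t"

text \<open>The derivative of \<open>log_deriv u\<close>, in closed form.\<close>

definition log_deriv' :: "(real \<Rightarrow> real) \<Rightarrow> real \<Rightarrow> real" where
  "log_deriv' u t = deriv (deriv u) t / u t - (log_deriv u t)\<^sup>2"

lemma log_deriv_derivative:
  assumes "\<And>t. (u has_real_derivative deriv u t) (at t)"
    "\<And>t. (deriv u has_real_derivative deriv (deriv u) t) (at t)"
    and "\<And>t. u t > 0"
  shows "(log_deriv u has_real_derivative log_deriv' u t) (at t)"
    and "((\<lambda>t. ln (u t)) has_real_derivative log_deriv u t) (at t)"
    and "(u has_real_derivative log_deriv u t * u t) (at t)"
proof -
  have "u t \<noteq> 0" using assms(3)[of t] by simp
  then show "(log_deriv u has_real_derivative log_deriv' u t) (at t)"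
    unfolding log_deriv_def[abs_def] log_deriv'_def
    by (auto intro!: derivative_eq_intros assms simp: field_simps power2_eq_square)
  show "((\<lambda>t. ln (u t)) has_real_derivative log_deriv u t) (at t)"
    unfolding log_deriv_def using assms(3)[of t]
    by (auto intro!: derivative_eq_intros assms)
  show "(u has_real_derivative log_deriv u t * u t) (at t)"
    using assms(1)[of t] \<open>u t \<noteq> 0\<close> by (simp add: log_deriv_def)
qed

text \<open>This is the scalar curvature of the warped metric over a scalar-flat fibre, divided by
  \<open>g(\<nabla>\<xi>, \<nabla>\<xi>) \<phi>\<^sup>2\<close>.\<close>

definition warped_scalar_expr ::
  "real \<Rightarrow> real \<Rightarrow> (real \<Rightarrow> real) \<Rightarrow> (real \<Rightarrow> real) \<Rightarrow> real \<Rightarrow> real" where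
  "warped_scalar_expr n m \<phi> f t =
     (n - 1) * (2 * log_deriv' \<phi> t - (n - 2) * (log_deriv \<phi> t)\<^sup>2)
     - 2 * m * log_deriv' f t - m * (m + 1) * (log_deriv f t)\<^sup>2
     + 2 * m * (n - 2) * log_deriv \<phi> t * log_deriv f t"

text \<open>The closed form of the warping function says, after taking logarithmic derivatives, that
  \<open>L = (n - 2) / (m + 1) p + z + 2 / (m + 1) B\<close>, where \<open>B\<close> is the logarithmic derivative of
  the outer antiderivative and satisfies \<open>B' = - (m + 1) z B - B\<^sup>2\<close>. With these two relations
  the terms in \<open>z B\<close>, \<open>B\<^sup>2\<close>, \<open>p z\<close> and \<open>p B\<close> cancel, and the vanishing of the scalar
  curvature turns into the Riccati equation for \<open>z\<close>. Both implications of the equivalence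
  rest on this identity.\<close>

lemma riccati_identity:
  fixes n m p p' z z' B :: real
  assumes m: "m > 0"
    and L: "L = (n - 2) / (m + 1) * p + z + 2 / (m + 1) * B"
    and L': "L' = (n - 2) / (m + 1) * p' + z' + 2 / (m + 1) * (- (m + 1) * z * B - B\<^sup>2)"
  shows "(n - 1) * (2 * p' - (n - 2) * p\<^sup>2) - 2 * m * L' - m * (m + 1) * L\<^sup>2 + 2 * m * (n - 2) * p * L
    = - m * (m + 1) * (z\<^sup>2 + 2 / (m + 1) * z'
        + (n + m - 1) / (m * (m + 1)\<^sup>2) * (n * p\<^sup>2 - 2 * (p' + p\<^sup>2)))"
proof -
  define M where "M = m + 1"
  have M: "M \<noteq> 0" "m \<noteq> 0" using m by (auto simp: M_def)
  have scaled_L: "M * L = (n - 2) * p + M * z + 2 * B"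
    unfolding L M_def[symmetric] using M by (simp add: field_simps)
  have scaled_L': "M * L' = (n - 2) * p' + M * z' + 2 * (- M * z * B - B\<^sup>2)"
    unfolding L' M_def[symmetric] using M by (simp add: field_simps)
  have R: "M\<^sup>2 * m * (z\<^sup>2 + 2 / M * z' + (n + m - 1) / (m * M\<^sup>2) * (n * p\<^sup>2 - 2 * (p' + p\<^sup>2)))
     = m * M\<^sup>2 * z\<^sup>2 + 2 * m * M * z' + (n + m - 1) * (n * p\<^sup>2 - 2 * (p' + p\<^sup>2))"
    using M by (simp add: field_simps power2_eq_square)
  have "M * ((n - 1) * (2 * p' - (n - 2) * p\<^sup>2) - 2 * m * L' - m * M * L\<^sup>2 + 2 * m * (n - 2) * p * L)
    = M * (n - 1) * (2 * p' - (n - 2) * p\<^sup>2) - 2 * m * (M * L') - m * (M * L)\<^sup>2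
      + 2 * m * (n - 2) * p * (M * L)"
    by (simp add: algebra_simps power2_eq_square)
  also have "\<dots> = - (m * M\<^sup>2 * z\<^sup>2 + 2 * m * M * z' + (n + m - 1) * (n * p\<^sup>2 - 2 * (p' + p\<^sup>2)))"
    unfolding scaled_L scaled_L' unfolding M_def by (simp add: algebra_simps power2_eq_square)
  also have "\<dots> = M * (- m * M * (z\<^sup>2 + 2 / M * z'
        + (n + m - 1) / (m * M\<^sup>2) * (n * p\<^sup>2 - 2 * (p' + p\<^sup>2))))"
    unfolding R[symmetric] by (simp add: power2_eq_square mult_ac)
  finally show ?thesis using M(1) unfolding M_def[symmetric] mult_cancel_left by blast
qed

lemma riccati_bracket:
  "n * (deriv \<phi> t / \<phi> t)\<^sup>2 - 2 * (deriv (deriv \<phi>) t / \<phi> t)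
    = n * (log_deriv \<phi> t)\<^sup>2 - 2 * (log_deriv' \<phi> t + (log_deriv \<phi> t)\<^sup>2)"
  by (simp add: log_deriv_def log_deriv'_def)

locale warping_profiles =
  fixes n m :: real and \<phi> f :: "real \<Rightarrow> real"
  assumes m_pos: "m > 0"
    and \<phi>1: "\<And>t. (\<phi> has_real_derivative deriv \<phi> t) (at t)"
    and \<phi>2: "\<And>t. (deriv \<phi> has_real_derivative deriv (deriv \<phi>) t) (at t)"
    and \<phi>_pos: "\<And>t. \<phi> t > 0"
    and f1: "\<And>t. (f has_real_derivative deriv f t) (at t)"
    and f2: "\<And>t. (deriv f has_real_derivative deriv (deriv f) t) (at t)"
    and f_pos: "\<And>t. f t > 0"
begin

lemmas \<phi>_log = log_deriv_derivative[OF \<phi>1 \<phi>2 \<phi>_pos]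
lemmas f_log = log_deriv_derivative[OF f1 f2 f_pos]

lemma nonzero: "\<phi> t \<noteq> 0" "f t \<noteq> 0" "m + 1 \<noteq> 0"
  using \<phi>_pos[of t] f_pos[of t] m_pos by auto

lemma expr_eq_riccati:
  assumes L: "log_deriv f t = (n - 2) / (m + 1) * log_deriv \<phi> t + z + 2 / (m + 1) * B"
    and L': "log_deriv' f t = (n - 2) / (m + 1) * log_deriv' \<phi> t + z'
               + 2 / (m + 1) * (- (m + 1) * z * B - B\<^sup>2)"
  shows "warped_scalar_expr n m \<phi> f t = - m * (m + 1) * (z\<^sup>2 + 2 / (m + 1) * z'
        + (n + m - 1) / (m * (m + 1)\<^sup>2) * (n * (deriv \<phi> t / \<phi> t)\<^sup>2 - 2 * (deriv (deriv \<phi>) t / \<phi> t)))"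
  unfolding warped_scalar_expr_def riccati_bracket by (rule riccati_identity[OF m_pos L L'])

text \<open>Taking logarithms of the closed form and differentiating twice gives the relations needed
  for the identity. The equation for \<open>f\<close> is known only on \<open>J\<close>, and openness of \<open>J\<close> is what
  allows differentiating it.\<close>

lemma warped_scalar_zero_if_formula:
  assumes J: "open J" "t \<in> J"
    and ric: "riccati_solution_on J n m \<phi> z" and form: "warping_formula_on J n m \<phi> f C z"
  shows "warped_scalar_expr n m \<phi> f t = 0"
proof -
  from form obtain Z1 Z2 E where Z1: "\<And>t. t \<in> J \<Longrightarrow> (Z1 has_real_derivative z t) (at t)"
    and Z2: "\<And>t. t \<in> J \<Longrightarrow> (Z2 has_real_derivative z t) (at t)"
    and E: "\<And>t. t \<in> J \<Longrightarrow> (E has_real_derivative exp (- (m + 1) * Z2 t)) (at t)"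
    and pos: "\<And>t. t \<in> J \<Longrightarrow> E t + 2 / (m + 1) * C > 0"
    and f: "\<And>t. t \<in> J \<Longrightarrow> f t = \<phi> t powr ((n - 2) / (m + 1)) * exp (Z1 t)
                * (E t + 2 / (m + 1) * C) powr (2 / (m + 1))"
    unfolding warping_formula_on_def antiderivative_on_def by metis
  define B where "B = (\<lambda>t. exp (- (m + 1) * Z2 t) / (E t + 2 / (m + 1) * C))"
  have B_deriv: "(B has_real_derivative - (m + 1) * z t * B t - (B t)\<^sup>2) (at t)" if "t \<in> J" for t
    unfolding B_def using pos[OF that]
    by (auto intro!: derivative_eq_intros Z2[OF that] E[OF that])
       (simp add: divide_simps power2_eq_square)
  have ln_f: "ln (f t) = (n - 2) / (m + 1) * ln (\<phi> t) + Z1 t + 2 / (m + 1) * ln (E t + 2 / (m + 1) * C)"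
    if "t \<in> J" for t
    unfolding f[OF that] using pos[OF that] \<phi>_pos[of t]
    by (simp add: ln_mult ln_powr)
  have L: "log_deriv f t = (n - 2) / (m + 1) * log_deriv \<phi> t + z t + 2 / (m + 1) * B t" if "t \<in> J" for t
  proof -
    have "((\<lambda>t. (n - 2) / (m + 1) * ln (\<phi> t) + Z1 t + 2 / (m + 1) * ln (E t + 2 / (m + 1) * C))
        has_real_derivative (n - 2) / (m + 1) * log_deriv \<phi> t + z t + 2 / (m + 1) * B t) (at t)"
      unfolding B_def using pos[OF that]
      by (auto intro!: derivative_eq_intros \<phi>_log(3) Z1[OF that] E[OF that] simp: \<phi>_pos nonzero mult.commute)
    then have "((\<lambda>t. ln (f t)) has_real_derivative
        (n - 2) / (m + 1) * log_deriv \<phi> t + z t + 2 / (m + 1) * B t) (at t)"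
      by (rule has_field_derivative_transform_within_open[OF _ J(1) that]) (simp add: ln_f)
    then show ?thesis using f_log(2) DERIV_unique by blast
  qed
  have z: "(z has_real_derivative deriv z t) (at t)"
    using ric J(2) unfolding riccati_solution_on_def
    by (auto simp: DERIV_deriv_iff_real_differentiable)
  have "((\<lambda>t. (n - 2) / (m + 1) * log_deriv \<phi> t + z t + 2 / (m + 1) * B t) has_real_derivative
      (n - 2) / (m + 1) * log_deriv' \<phi> t + deriv z t + 2 / (m + 1) * (- (m + 1) * z t * B t - (B t)\<^sup>2)) (at t)"
    by (intro DERIV_add DERIV_cmult \<phi>_log z B_deriv J)
  then have "(log_deriv f has_real_derivative
      (n - 2) / (m + 1) * log_deriv' \<phi> t + deriv z t + 2 / (m + 1) * (- (m + 1) * z t * B t - (B t)\<^sup>2)) (at t)"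
    by (rule has_field_derivative_transform_within_open[OF _ J]) (simp add: L)
  then have L': "log_deriv' f t = (n - 2) / (m + 1) * log_deriv' \<phi> t + deriv z t
      + 2 / (m + 1) * (- (m + 1) * z t * B t - (B t)\<^sup>2)"
    using f_log(1) DERIV_unique by blast
  show ?thesis
    unfolding expr_eq_riccati[OF L[OF J(2)] L'] using ric J(2) by (simp add: riccati_solution_on_def)
qed

text \<open>Put \<open>u = f\<^bsup>(m+1)/2\<^esup> \<phi>\<^bsup>-(n-2)/2\<^esup>\<close>, which on the interval solves a linear
  equation \<open>u'' + q u = 0\<close>. Reduction
  of order gives the further solutions \<open>u v\<close> with \<open>v' = - u\<^sup>-\<^sup>2\<close>, and a bounded interval leaves
  room for the constant of integration to be so large that \<open>v > 0\<close> throughout. The logarithmic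
  derivative of \<open>u v\<close>, scaled by \<open>2 / (m + 1)\<close>, is the required \<open>z\<close>. As \<open>1 / v\<close> is an
  antiderivative of \<open>(u v)\<^sup>-\<^sup>2\<close> and \<open>u = u v \<cdot> (1 / v)\<close>, the closed form holds with \<open>C = 0\<close>.\<close>

lemma formula_if_warped_scalar_zero:
  assumes zero: "\<And>t. t \<in> {a<..<b} \<Longrightarrow> warped_scalar_expr n m \<phi> f t = 0"
  obtains z where "riccati_solution_on {a<..<b} n m \<phi> z" "warping_formula_on {a<..<b} n m \<phi> f 0 z"
proof -
  (* In terms of u, this is 1 / u\<^sup>2. *)
  define g where "g = (\<lambda>t. f t powr - (m + 1) * \<phi> t powr (n - 2))"
  have g_deriv: "(g has_real_derivative (- (m + 1) * log_deriv f t + (n - 2) * log_deriv \<phi> t) * g t) (at t)" for t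
  proof -
    have g: "g = (\<lambda>t. exp (- (m + 1) * ln (f t) + (n - 2) * ln (\<phi> t)))"
      using f_pos \<phi>_pos by (auto simp: g_def fun_eq_iff powr_def exp_add less_le)
    show ?thesis unfolding g
      by (auto intro!: derivative_eq_intros f_log(3) \<phi>_log(3) simp: f_pos \<phi>_pos nonzero)
  qed
  have "continuous_on {a..b} g"
    by (rule DERIV_continuous_on[OF has_field_derivative_at_within[OF g_deriv]])
  (* One-sided derivatives at a and b make I continuous up to the end points, hence bounded. *)
  then obtain I where I: "\<And>t. t \<in> {a..b} \<Longrightarrow> (I has_vector_derivative g t) (at t within {a..b})"
    using antiderivative_continuous[of a b g] by auto
  have "continuous_on {a..b} I"
    unfolding continuous_on_eq_continuous_within
    using has_vector_derivative_continuous[OF I] by auto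
  then have "bounded (I ` {a..b})"
    by (intro compact_imp_bounded compact_continuous_image compact_Icc)
  then obtain K where K: "\<And>t. t \<in> {a..b} \<Longrightarrow> \<bar>I t\<bar> \<le> K"
    unfolding bounded_iff by (metis imageI real_norm_def)
  define v where "v = (\<lambda>t. K + 1 - I t)"
  have v_pos: "v t > 0" if "t \<in> {a<..<b}" for t
    using K[of t] that by (auto simp: v_def abs_le_iff)
  have v_deriv: "(v has_real_derivative - g t) (at t)" if "t \<in> {a<..<b}" for t
  proof -
    have "(I has_real_derivative g t) (at t)"
      using I[of t] that at_within_Icc_at[of a t b] by (simp add: has_real_derivative_iff_has_vector_derivative)
    then show ?thesis unfolding v_def by (auto intro!: derivative_eq_intros)
  qed
  define B where "B = (\<lambda>t. g t / v t)"
  (* Solving the relation for L for z makes this the scaled logarithmic derivative of u v,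
     because B = - v' / v. *)
  define z where "z = (\<lambda>t. log_deriv f t - (n - 2) / (m + 1) * log_deriv \<phi> t - 2 / (m + 1) * B t)"
  have m1: "m + 1 \<noteq> 0" using m_pos by simp
  have B_deriv: "(B has_real_derivative - (m + 1) * z t * B t - (B t)\<^sup>2) (at t)" if "t \<in> {a<..<b}" for t
  proof -
    have "(B has_real_derivative (- (m + 1) * log_deriv f t + (n - 2) * log_deriv \<phi> t) * B t + (B t)\<^sup>2) (at t)"
      unfolding B_def using v_pos[OF that]
      by (auto intro!: derivative_eq_intros g_deriv v_deriv[OF that] simp: field_simps power2_eq_square)
    moreover have "(- (m + 1) * log_deriv f t + (n - 2) * log_deriv \<phi> t) * B t + (B t)\<^sup>2
        = - (m + 1) * z t * B t - (B t)\<^sup>2"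
    proof -
      have *: "(m + 1) * z t = (m + 1) * log_deriv f t - (n - 2) * log_deriv \<phi> t - 2 * B t"
        unfolding z_def right_diff_distrib using m1 by simp
      have "- (m + 1) * z t * B t = - ((m + 1) * z t) * B t" by (simp only: mult_minus_left)
      also have "\<dots> = - ((m + 1) * log_deriv f t - (n - 2) * log_deriv \<phi> t - 2 * B t) * B t"
        unfolding * ..
      finally show ?thesis by (simp add: algebra_simps power2_eq_square)
    qed
    ultimately show ?thesis by (simp only:)
  qed
  define z' where "z' = (\<lambda>t. log_deriv' f t - (n - 2) / (m + 1) * log_deriv' \<phi> t
     - 2 / (m + 1) * (- (m + 1) * z t * B t - (B t)\<^sup>2))"
  have z_deriv: "(z has_real_derivative z' t) (at t)" if "t \<in> {a<..<b}" for t
  proof -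
    have "((\<lambda>t. log_deriv f t - (n - 2) / (m + 1) * log_deriv \<phi> t - 2 / (m + 1) * B t)
       has_real_derivative z' t) (at t)" unfolding z'_def
      by (intro DERIV_diff DERIV_cmult f_log(1) \<phi>_log(1) B_deriv[OF that])
    then show ?thesis unfolding z_def .
  qed
  have ric: "riccati_solution_on {a<..<b} n m \<phi> z"
    unfolding riccati_solution_on_def
  proof (intro ballI conjI)
    fix t assume t: "t \<in> {a<..<b}"
    show "z differentiable (at t)"
      using z_deriv[OF t] by (auto simp: real_differentiable_def)
    have dz: "deriv z t = z' t" using z_deriv[OF t] by (rule DERIV_imp_deriv)
    have "log_deriv f t = (n - 2) / (m + 1) * log_deriv \<phi> t + z t + 2 / (m + 1) * B t"
      by (simp add: z_def)
    moreover have "log_deriv' f t = (n - 2) / (m + 1) * log_deriv' \<phi> t + z' t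
       + 2 / (m + 1) * (- (m + 1) * z t * B t - (B t)\<^sup>2)" by (simp add: z'_def)
    ultimately have "0 = - m * (m + 1) * ((z t)\<^sup>2 + 2 / (m + 1) * z' t
        + (n + m - 1) / (m * (m + 1)\<^sup>2) * (n * (deriv \<phi> t / \<phi> t)\<^sup>2 - 2 * (deriv (deriv \<phi>) t / \<phi> t)))"
      using expr_eq_riccati[of t "z t" "B t" "z' t"] zero[OF t] by simp
    then show "(z t)\<^sup>2 + 2 / (m + 1) * deriv z t + (n + m - 1) / (m * (m + 1)\<^sup>2)
        * (n * (deriv \<phi> t / \<phi> t)\<^sup>2 - 2 * (deriv (deriv \<phi>) t / \<phi> t)) = 0"
      unfolding dz using m_pos m1 by simp
  qed
  define Z where "Z = (\<lambda>t. ln (f t) - (n - 2) / (m + 1) * ln (\<phi> t) + 2 / (m + 1) * ln (v t))"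
  have Z: "(Z has_real_derivative z t) (at t)" if "t \<in> {a<..<b}" for t
    unfolding Z_def z_def B_def using v_pos[OF that]
    by (auto intro!: derivative_eq_intros f_log(3) \<phi>_log(3) v_deriv[OF that] simp: f_pos \<phi>_pos nonzero mult.commute)
  have "(m + 1) * Z t = (m + 1) * ln (f t) - (n - 2) * ln (\<phi> t) + 2 * ln (v t)" for t
    unfolding Z_def distrib_left right_diff_distrib using m1 by simp
  then have "- (m + 1) * Z t = - (m + 1) * ln (f t) + (n - 2) * ln (\<phi> t) - 2 * ln (v t)" for t
    by (simp only: mult_minus_left)
  then have exp_Z: "exp (- (m + 1) * Z t) = g t / (v t)\<^sup>2" if "t \<in> {a<..<b}" for t
    using f_pos[of t] \<phi>_pos[of t] v_pos[OF that]
    by (simp add: g_def powr_def exp_diff exp_add[symmetric] exp_double nonzero less_imp_neq[THEN not_sym])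
  have E: "((\<lambda>t. 1 / v t) has_real_derivative exp (- (m + 1) * Z t)) (at t)" if "t \<in> {a<..<b}" for t
    unfolding exp_Z[OF that] using v_pos[OF that]
    by (auto intro!: derivative_eq_intros v_deriv[OF that] simp: power2_eq_square)
  have "f t = \<phi> t powr ((n - 2) / (m + 1)) * exp (Z t) * (1 / v t + 2 / (m + 1) * 0) powr (2 / (m + 1))"
    if "t \<in> {a<..<b}" for t
    using f_pos[of t] \<phi>_pos[of t] v_pos[OF that]
    by (simp add: Z_def powr_def exp_add exp_diff ln_div exp_minus)
  then have "warping_formula_on {a<..<b} n m \<phi> f 0 z"
    unfolding warping_formula_on_def antiderivative_on_def
    using Z E v_pos by (intro exI[of _ Z] exI[of _ "\<lambda>t. 1 / v t"]) simp
  with ric that show ?thesis by blast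
qed

end

section \<open>The warped product manifold\<close>

lemma smooth_on_Ck2:
  "smooth_on S u \<Longrightarrow> Ck_on (Suc (Suc 0)) S u"
  by (simp add: smooth_on_def del: Ck_on.simps)

text \<open>Christoffel symbols contain the first derivatives of the metric, so twice differentiable
  components suffice for them to be differentiable.\<close>

lemma smooth_metric_differentiable:
  fixes H :: "real^'k::finite \<Rightarrow> real^'k^'k"
  assumes H: "smooth_on U H" and U: "open U" "y \<in> U" and inv: "\<And>y. y \<in> U \<Longrightarrow> invertible (H y)"
  shows "(\<lambda>y. H y $ i $ j) differentiable (at y)" "christoffel H l i j differentiable (at y)"
proof -
  have entry: "bounded_linear (\<lambda>A :: real^'k^'k. A $ i $ j)" for i j
    using bounded_linear_compose[OF bounded_linear_vec_nth bounded_linear_vec_nth] .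
  have dH: "H differentiable (at x)" if "x \<in> U" for x
    using smooth_on_Ck2[OF H] that by simp
  have ddH: "(\<lambda>x. frechet_derivative H (at x) v) differentiable (at y)" for v
    using smooth_on_Ck2[OF H] U(2) by simp
  have entry_diff: "(\<lambda>x. h x $ i $ j) differentiable (at x)"
    if "h differentiable (at x)" for h :: "real^'k \<Rightarrow> real^'k^'k" and x i j
    using that has_derivative_compose[OF _ bounded_linear_imp_has_derivative[OF entry]]
    unfolding differentiable_def by blast
  show 1: "(\<lambda>y. H y $ i $ j) differentiable (at y)" for i j
    by (rule entry_diff[OF dH[OF U(2)]])
  have pd_entry: "pd s (\<lambda>y. H y $ i $ j) x = frechet_derivative H (at x) (axis s 1) $ i $ j"
    if "x \<in> U" for s i j x
  proof -
    have "(H has_derivative frechet_derivative H (at x)) (at x)"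
      using dH[OF that] frechet_derivative_works by blast
    from has_derivative_compose[OF this bounded_linear_imp_has_derivative[OF entry]]
    show ?thesis unfolding pd_def by (subst frechet_derivative_at[symmetric]) auto
  qed
  have 2: "(\<lambda>x. pd s (\<lambda>y. H y $ i $ j) x) differentiable (at y)" for s i j
    by (rule differentiable_transform_open[OF entry_diff[OF ddH] U]) (simp add: pd_entry)
  have 3: "(\<lambda>x. matrix_inv (H x) $ l $ s) differentiable (at y)" for s
    by (rule differentiable_matrix_inv[OF U inv 1])
  have "(\<lambda>x. (\<Sum>s\<in>UNIV. matrix_inv (H x) $ l $ s *
     (pd i (\<lambda>y. H y $ j $ s) x + pd j (\<lambda>y. H y $ i $ s) x - pd s (\<lambda>y. H y $ i $ j) x)) * (1 / 2))
      differentiable (at y)"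
    by (intro differentiable_sum differentiable_mult differentiable_add differentiable_diff differentiable_const
        2 3 ballI finite)
  then show "christoffel H l i j differentiable (at y)"
    by (simp add: christoffel_def[abs_def])
qed

lemma param_prod_euclidean:
  fixes F :: "('p, 'i, 'm::finite) charted" and x :: "real^'n::finite"
  assumes "y \<in> chart F j ` cdom F j" "inj_on (chart F j) (cdom F j)"
  shows "param (prod_manifold euclidean_manifold F) ((), j) (vec_join x y) = (x, param F j y)"
proof -
  let ?M = "prod_manifold (euclidean_manifold :: (real^'n, unit, 'n) charted) F"
  obtain q where q: "q \<in> cdom F j" "y = chart F j q" using assms(1) by blast
  have chart: "chart ?M ((), j) = (\<lambda>(p, q). vec_join p (chart F j q))"
    and dom: "cdom ?M ((), j) = UNIV \<times> cdom F j"
    by (simp_all add: prod_manifold_def euclidean_manifold_def)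
  have join_inj: "a = c \<and> b = d" if "vec_join a b = vec_join c d" for a c :: "real^'n" and b d :: "real^'m"
  proof -
    have "vec_join a b $ Inl k = vec_join c d $ Inl k" "vec_join a b $ Inr l = vec_join c d $ Inr l" for k l
      using that by simp_all
    then show ?thesis by (simp add: vec_join_def vec_eq_iff)
  qed
  have "inj_on (chart ?M ((), j)) (cdom ?M ((), j))"
    unfolding chart dom by (rule inj_onI) (auto dest!: join_inj dest: inj_onD[OF assms(2)])
  from inv_into_f_f[OF this, of "(x, q)"] q
  have "param ?M ((), j) (vec_join x y) = (x, q)"
    unfolding param_def by (simp add: chart dom)
  moreover have "param F j y = q"
    unfolding param_def q(2) by (rule inv_into_f_f[OF assms(2) q(1)])
  ultimately show ?thesis by simp
qed

lemma vec_join_parts: "vec_join (\<chi> a. z $ Inl a) (fibre_part z) = z"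
  by (simp add: vec_join_def fibre_part_def vec_eq_iff split: sum.split)

text \<open>In the product chart the representative of the metric has the block form studied above on
  the open set of points whose fibre coordinates lie in the chart image, so its scalar
  curvature can be read off there.\<close>

lemma warped_product_scalar_curvature:
  fixes \<epsilon> :: "'n::finite \<Rightarrow> real" and \<alpha> :: "real^'n"
    and F :: "('p, 'i, 'm::finite) charted" and gF :: "('p, 'i, 'm) metric"
  assumes eps: "\<forall>k. \<epsilon> k \<in> {-1, 1}"
    and F: "semi_riemannian_manifold F gF"
    and profiles: "warping_profiles (real CARD('m)) \<phi>1 f1"
    and f_eq: "\<forall>x. f x = f1 (\<Sum>k\<in>UNIV. \<alpha> $ k * x $ k)"
    and \<phi>_eq: "\<forall>x. \<phi> x = \<phi>1 (\<Sum>k\<in>UNIV. \<alpha> $ k * x $ k)"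
    and j: "j \<in> idx F" and q: "q \<in> cdom F j"
  defines "\<xi> \<equiv> \<lambda>x. \<Sum>k\<in>UNIV. \<alpha> $ k * x $ k"
  shows "scalar_curvature (prod_manifold euclidean_manifold F)
           (warped_metric (conformal_metric \<phi> (pseudo_euclidean_metric \<epsilon>)) f gF) ((), j) (x, q)
     = scalar_curvature F gF j q / (f x)\<^sup>2
       + (\<Sum>k\<in>UNIV. \<epsilon> k * (\<alpha> $ k)\<^sup>2) * (\<phi> x)\<^sup>2
         * warped_scalar_expr (real CARD('n)) (real CARD('m)) \<phi>1 f1 (\<xi> x)"
proof -
  interpret warping_profiles "real CARD('n)" "real CARD('m)" \<phi>1 f1 by (rule profiles)
  let ?M = "prod_manifold (euclidean_manifold :: (real^'n, unit, 'n) charted) F"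
  define U where "U = chart F j ` cdom F j"
  define H where "H = gF j \<circ> param F j"
  let ?g = "warped_metric (conformal_metric \<phi> (pseudo_euclidean_metric \<epsilon>)) f gF"
  define G where "G = ?g ((), j) \<circ> param ?M ((), j)"
  have man: "openin (topo F) (cdom F j)" "open U"
    "homeomorphic_map (subtopology (topo F) (cdom F j)) (top_of_set U) (chart F j)"
    using F j unfolding semi_riemannian_manifold_def smooth_manifold_def U_def by auto
  have inj: "inj_on (chart F j) (cdom F j)"
    using homeomorphic_imp_injective_map[OF man(3)] openin_subset[OF man(1)]
    by (simp add: Int_absorb1)
  have param_in: "param F j y \<in> cdom F j" if "y \<in> U" for y
    using that unfolding param_def U_def by (rule inv_into_into)
  have H_smooth: "smooth_on U H"
    using F j unfolding semi_riemannian_manifold_def U_def H_def by auto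
  have H_alg: "transpose (H y) = H y" "invertible (H y)" if "y \<in> U" for y
    using F j param_in[OF that] unfolding semi_riemannian_manifold_def H_def by auto
  have G_eq: "G z = block_diag ((1 / (\<phi>1 (height \<alpha> z))\<^sup>2) *\<^sub>R (\<chi> a b. if a = b then \<epsilon> a else 0))
              ((f1 (height \<alpha> z))\<^sup>2 *\<^sub>R H (fibre_part z))" if "fibre_part z \<in> U" for z
  proof -
    have "param ?M ((), j) (vec_join (\<chi> a. z $ Inl a) (fibre_part z))
        = (\<chi> a. z $ Inl a, param F j (fibre_part z))"
      by (rule param_prod_euclidean[OF _ inj]) (use that in \<open>simp add: U_def\<close>)
    then show ?thesis
      by (simp add: G_def vec_join_parts warped_metric_def conformal_metric_def pseudo_euclidean_metric_def
          H_def f_eq \<phi>_eq height_def)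
  qed
  interpret warped_block \<epsilon> \<alpha> \<phi>1 f1 "log_deriv \<phi>1" "log_deriv f1" "log_deriv' \<phi>1" "log_deriv' f1" H U G
  proof
    show "\<epsilon> a * \<epsilon> a = 1" for a using eps[rule_format, of a] by auto
    show "(\<lambda>y. H y $ i $ j) differentiable (at y)" "christoffel H l i j differentiable (at y)"
      if "y \<in> U" for i j l y
      using smooth_metric_differentiable[OF H_smooth man(2) that H_alg(2)] by auto
  qed (use \<phi>_log f_log nonzero man(2) H_alg G_eq in auto)
  define z where "z = vec_join x (chart F j q)"
  have z: "fibre_part z = chart F j q" "height \<alpha> z = \<xi> x"
    by (simp_all add: z_def fibre_part_def height_def vec_join_def \<xi>_def vec_eq_iff)
  have "z \<in> chart_region" unfolding chart_region_def using q by (simp add: z U_def)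
  have "scalar_curvature ?M ?g ((), j) (x, q) = scalar_coord G z"
    by (simp add: scalar_curvature_def G_def z_def prod_manifold_def euclidean_manifold_def)
  moreover have "scalar_coord H (fibre_part z) = scalar_curvature F gF j q"
    by (simp add: scalar_curvature_def H_def z)
  ultimately show ?thesis
    using scalar_G[OF \<open>z \<in> chart_region\<close>] unfolding z(2)
    by (simp add: warped_scalar_expr_def grad_sq_def f_eq \<phi>_eq \<xi>_def)
qed

lemma hessian_constant:
  fixes M :: "('p, 'i, 'k::finite) charted"
  shows "hessian M g (\<lambda>_. c) i p = 0"
proof -
  have "pd k (\<lambda>_. c) = (\<lambda>_. 0)" for k :: 'k and c by (simp add: pd_def fun_eq_iff)
  then show ?thesis by (simp add: hessian_def hessian_coord_def vec_eq_iff comp_def)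
qed

section \<open>Steady solitons with constant potential\<close>

theorem theorem1p9:
  fixes \<epsilon> :: "'n::finite \<Rightarrow> real" and \<alpha> :: "real^'n"
    and F :: "('p, 'i, 'm::finite) charted" and gF :: "('p, 'i, 'm) metric"
    and f \<phi> h :: "real^'n \<Rightarrow> real" and f1 \<phi>1 h1 :: "real \<Rightarrow> real"
  assumes "CARD('n) \<ge> 3"
    and "\<forall>k. \<epsilon> k \<in> {-1, 1}"
    and "(\<Sum>k\<in>UNIV. \<epsilon> k * (\<alpha> $ k)\<^sup>2) \<in> {-1, 1}"
    and "semi_riemannian_manifold F gF" and "scalar_flat F gF"
    and "smooth_on UNIV f" and "smooth_on UNIV \<phi>" and "smooth_on UNIV h"
    and "\<forall>x. f x > 0" and "\<forall>x. \<phi> x > 0"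
    and "\<forall>x. f x = f1 (\<Sum>k\<in>UNIV. \<alpha> $ k * x $ k)"
    and "\<forall>x. \<phi> x = \<phi>1 (\<Sum>k\<in>UNIV. \<alpha> $ k * x $ k)"
    and "\<forall>x. h x = h1 (\<Sum>k\<in>UNIV. \<alpha> $ k * x $ k)"
  shows "steady_gradient_yamabe_soliton
           (prod_manifold euclidean_manifold F)
           (warped_metric (conformal_metric \<phi> (pseudo_euclidean_metric \<epsilon>)) f gF)
           (\<lambda>(x, p). h x)
         \<and> (\<forall>\<xi>. deriv h1 \<xi> = 0)
     \<longleftrightarrow> (\<exists>c. \<forall>\<xi>. h1 \<xi> = c)
         \<and> (\<forall>a b. a < b \<longrightarrow> (\<exists>C z.
              riccati_solution_on {a<..<b} (real CARD('n)) (real CARD('m)) \<phi>1 z \<and>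
              warping_formula_on {a<..<b} (real CARD('n)) (real CARD('m)) \<phi>1 f1 C z))"
proof -
  let ?n = "real CARD('n)" and ?m = "real CARD('m)"
  let ?M = "prod_manifold (euclidean_manifold :: (real^'n, unit, 'n) charted) F"
  let ?g = "warped_metric (conformal_metric \<phi> (pseudo_euclidean_metric \<epsilon>)) f gF"
  let ?e = "\<Sum>k\<in>UNIV. \<epsilon> k * (\<alpha> $ k)\<^sup>2"
  define \<xi> where "\<xi> = (\<lambda>x :: real^'n. \<Sum>k\<in>UNIV. \<alpha> $ k * x $ k)"
  (* The gradient of \<xi>, up to sign: the line through it meets every level set of \<xi>, so identities
     along the line determine the profiles. *)
  define w :: "real^'n" where "w = (\<chi> k. ?e * \<epsilon> k * \<alpha> $ k)"
  have e: "?e * ?e = 1" "?e \<noteq> 0" using assms(3) by auto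
  have "\<xi> w = ?e * ?e"
    unfolding \<xi>_def w_def sum_distrib_left by (intro sum.cong) (simp_all add: power2_eq_square)
  then have \<xi>_w: "\<xi> (t *\<^sub>R w) = t" for t
    using e(1) by (simp add: \<xi>_def sum_distrib_left[symmetric] mult.left_commute)
  have profile: "u1 t = u (t *\<^sub>R w)" if "\<forall>x. u x = u1 (\<Sum>k\<in>UNIV. \<alpha> $ k * x $ k)"
    for u :: "real^'n \<Rightarrow> real" and u1 t
    using that \<xi>_w[of t] by (simp add: \<xi>_def)
  interpret warping_profiles ?n ?m \<phi>1 f1
  proof
    show "\<phi>1 t > 0" "f1 t > 0" for t
      using assms(9,10) profile[OF assms(11)] profile[OF assms(12)] by auto
  qed (use smooth_profile_derivatives[OF assms(6) profile[OF assms(11)]]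
      smooth_profile_derivatives[OF assms(7) profile[OF assms(12)]] in simp_all)
  obtain j0 q0 where j0: "j0 \<in> idx F" "q0 \<in> cdom F j0"
    using assms(4) unfolding semi_riemannian_manifold_def smooth_manifold_def by blast
  have scal: "scalar_curvature ?M ?g ((), j) (x, q) = ?e * (\<phi> x)\<^sup>2 * warped_scalar_expr ?n ?m \<phi>1 f1 (\<xi> x)"
    if "j \<in> idx F" "q \<in> cdom F j" for j q x
  proof -
    have "scalar_curvature F gF j q = 0"
      using assms(5) that by (simp add: scalar_flat_def)
    then show ?thesis
      using warped_product_scalar_curvature[OF assms(2,4) warping_profiles_axioms assms(11,12) that]
      by (simp add: \<xi>_def)
  qed
  have soliton_iff: "steady_gradient_yamabe_soliton ?M ?g (\<lambda>(x, p). h x)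
      \<longleftrightarrow> (\<forall>t. warped_scalar_expr ?n ?m \<phi>1 f1 t = 0)" if c: "\<And>t. h1 t = c" for c
  proof -
    have h: "(\<lambda>(x, p). h x) = (\<lambda>_ :: (real^'n) \<times> 'p. c)" using assms(13) c by auto
    have soliton: "steady_gradient_yamabe_soliton ?M ?g (\<lambda>(x, p). h x) \<longleftrightarrow>
       (\<forall>j\<in>idx F. \<forall>q\<in>cdom F j. \<forall>x. (?e * (\<phi> x)\<^sup>2 * warped_scalar_expr ?n ?m \<phi>1 f1 (\<xi> x)) *\<^sub>R ?g ((), j) (x, q) = 0)"
      unfolding h steady_gradient_yamabe_soliton_def yamabe_soliton_eq_def hessian_constant
      by (auto simp: prod_manifold_def euclidean_manifold_def scal[unfolded prod_manifold_def euclidean_manifold_def, simplified])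
    have "warped_scalar_expr ?n ?m \<phi>1 f1 t = 0"
      if zero: "\<And>x. (?e * (\<phi> x)\<^sup>2 * warped_scalar_expr ?n ?m \<phi>1 f1 (\<xi> x)) *\<^sub>R ?g ((), j0) (x, q0) = 0" for t
    proof -
      obtain k :: 'n where True by blast
      (* The metric does not vanish, so its coefficient must. *)
      have "?g ((), j0) (t *\<^sub>R w, q0) $ Inl k $ Inl k = \<epsilon> k / (\<phi> (t *\<^sub>R w))\<^sup>2"
        by (simp add: warped_metric_def block_diag_def conformal_metric_def pseudo_euclidean_metric_def)
      moreover have "\<epsilon> k \<noteq> 0" "\<phi> (t *\<^sub>R w) \<noteq> 0"
        using assms(2)[rule_format, of k] assms(10)[rule_format, of "t *\<^sub>R w"] by auto
      ultimately have "?g ((), j0) (t *\<^sub>R w, q0) \<noteq> 0"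
        by (metis divide_eq_0_iff power_eq_0_iff zero_index)
      then show ?thesis
        using zero[of "t *\<^sub>R w"] e(2) \<open>\<phi> (t *\<^sub>R w) \<noteq> 0\<close> by (simp add: \<xi>_w)
    qed
    then show ?thesis unfolding soliton using j0 by auto
  qed
  have formula_iff: "(\<forall>t. warped_scalar_expr ?n ?m \<phi>1 f1 t = 0) \<longleftrightarrow>
    (\<forall>a b. a < b \<longrightarrow> (\<exists>C z. riccati_solution_on {a<..<b} ?n ?m \<phi>1 z \<and>
       warping_formula_on {a<..<b} ?n ?m \<phi>1 f1 C z))" (is "?L \<longleftrightarrow> ?R")
  proof
    assume ?L
    then show ?R using formula_if_warped_scalar_zero by metis
  next
    assume R: ?R
    show ?L
    proof
      fix t :: real
      obtain C z where "riccati_solution_on {t - 1<..<t + 1} ?n ?m \<phi>1 z"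
        "warping_formula_on {t - 1<..<t + 1} ?n ?m \<phi>1 f1 C z"
        using R[rule_format, of "t - 1" "t + 1"] by auto
      then show "warped_scalar_expr ?n ?m \<phi>1 f1 t = 0"
        by (rule warped_scalar_zero_if_formula[rotated 2]) auto
    qed
  qed
  have const_iff: "(\<forall>t. deriv h1 t = 0) \<longleftrightarrow> (\<exists>c. \<forall>t. h1 t = c)"
  proof
    assume "\<forall>t. deriv h1 t = 0"
    then have "(h1 has_real_derivative 0) (at t)" for t
      using smooth_profile_derivatives(1)[OF assms(8) profile[OF assms(13)]] by simp
    then have "h1 t = h1 0" for t using DERIV_isconst_all by blast
    then show "\<exists>c. \<forall>t. h1 t = c" by blast
  next
    assume "\<exists>c. \<forall>t. h1 t = c"
    then obtain c where "h1 = (\<lambda>_. c)" by auto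
    then show "\<forall>t. deriv h1 t = 0" by simp
  qed
  show ?thesis
    using soliton_iff formula_iff const_iff by auto
qed

end
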